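(* Let $t\ge 3$ and $n\ge 2t+17$ be integers. Every 3-graph $H$ on $n$ vertices with $$\delta_1(H)\ge \frac{t-1}{2}n+\frac32 t^2-\frac92 t+6$$ contains a linear path of length $t$.
   Context: A 3-graph is a simple 3-uniform hypergraph; $\delta_1(H)$ is the minimum over vertices of the number of edges containing the vertex. A linear path of length $k$ is a collection of $k$ edges $e_1,\dots,e_k$ with $|e_i\cap e_j|=1$ if $|i-j|=1$ and $e_i\cap e_j=\emptyset$ otherwise. *)

theory Defs
  imports Complex_Main
begin

definition three_graph :: "'a set \<Rightarrow> 'a set set \<Rightarrow> bool" where
  "three_graph V E \<longleftrightarrow> finite V \<and> (\<forall>e\<in>E. e \<subseteq> V \<and> card e = 3)"

definition vertex_degree :: "'a set set \<Rightarrow> 'a \<Rightarrow> nat" where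
  "vertex_degree E v = card {e \<in> E. v \<in> e}"

(* Only meaningful for finite nonempty V. *)
definition min_vertex_degree :: "'a set \<Rightarrow> 'a set set \<Rightarrow> nat" where
  "min_vertex_degree V E = Min (vertex_degree E ` V)"

(* The list es is the sequence of edges of the path. Its entries are automatically
   distinct when they are 3-sets, since distinct positions meet in at most one vertex. *)
definition linear_path :: "'a set list \<Rightarrow> bool" where
  "linear_path es \<longleftrightarrow>
     (\<forall>i j. i < j \<longrightarrow> j < length es \<longrightarrow>
        (if j = i + 1 then card (es ! i \<inter> es ! j) = 1 else es ! i \<inter> es ! j = {}))"

definition contains_linear_path :: "'a set set \<Rightarrow> nat \<Rightarrow> bool" where
  "contains_linear_path E k \<longleftrightarrow>
     (\<exists>es. length es = k \<and> set es \<subseteq> E \<and> linear_path es)"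

end

theory Submission
  imports Defs
begin

text \<open>
  Suppose the longest linear path has length \<open>k\<close> with \<open>2 \<le> k < t\<close>, and let \<open>m \<ge> 18\<close> be the number of
  vertices outside it. An end \<open>a\<close> of the path has no edge to two outside vertices, so its degree
  forces the codegrees \<open>d(a, x)\<close> into the outside to sum to at least \<open>(k m + k\<^sup>2 + 6) / 2\<close> over the
  path vertices \<open>x\<close>. Call \<open>x\<close> fat for \<open>a\<close> if \<open>d(a, x) \<ge> 4\<close>. A closed linear path of length \<open>k + 1\<close>
  that survives exchanging one outside vertex is impossible, since the discarded vertex has an edge
  meeting one of the two cycles in exactly one vertex. Hence, as in Dirac's theorem, every edge of the
  path which a fat neighbour of \<open>a\<close> marks is free of neighbours of the opposite end, so the marks of
  the two ends are disjoint. An end has at least as many marks as fat neighbours unless these contain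
  a long block; then the end can be spliced into the interior of the path, and splicing in both
  vertices that can serve as the same end gains an edge. With ends chosen to have no block, the
  two ends together have at most \<open>k\<close> fat neighbours, contradicting the lower bound for the codegrees.
\<close>

section \<open>Linear paths carrying their vertex set\<close>

text \<open>In each edge \<open>x\<close> and \<open>y\<close> are the junctions and
  \<open>w\<close> the free vertex. With the vertex set as an argument, disjointness from all later
  edges is just two non-memberships; a single vertex is a path of length 0.\<close>

inductive lseg :: "'a set set \<Rightarrow> nat \<Rightarrow> 'a \<Rightarrow> 'a \<Rightarrow> 'a set \<Rightarrow> bool" for E where
  nil: "lseg E 0 x x {x}"
| cons: "{x, w, y} \<in> E \<Longrightarrow> x \<noteq> w \<Longrightarrow> lseg E n y z X \<Longrightarrow> x \<notin> X \<Longrightarrow> w \<notin> X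
    \<Longrightarrow> lseg E (Suc n) x z (insert x (insert w X))"

lemma lseg_ends: "lseg E n x z X \<Longrightarrow> x \<in> X \<and> z \<in> X"
  by (induction rule: lseg.induct) auto

lemma lseg_card: "lseg E n x z X \<Longrightarrow> finite X \<and> card X = 2 * n + 1"
  by (induction rule: lseg.induct) auto

lemma lseg_SucE:
  assumes "lseg E (Suc n) x z X"
  obtains w y Y where "{x, w, y} \<in> E" "x \<noteq> w" "lseg E n y z Y" "x \<notin> Y" "w \<notin> Y"
    "X = insert x (insert w Y)"
  using assms by (cases rule: lseg.cases) auto

lemma lseg_append:
  assumes "lseg E n x y X" "lseg E m y z Y" "X \<inter> Y = {y}"
  shows "lseg E (n + m) x z (X \<union> Y)"
  using assms
proof (induction rule: lseg.induct)
  case (nil x)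
  then show ?case using lseg_ends by (metis Un_insert_left add_0 insert_absorb sup_bot_left)
next
  case (cons x w y' n y X)
  have y: "y \<in> X" using cons.hyps lseg_ends by metis
  then have XY: "X \<inter> Y = {y}" using cons.prems(2) by auto
  have "x \<noteq> y" "w \<noteq> y" using y cons.hyps by auto
  then have "x \<notin> Y" "w \<notin> Y" using cons.prems(2) by blast+
  then have "lseg E (Suc (n + m)) x z (insert x (insert w (X \<union> Y)))"
    using cons XY by (intro lseg.cons[of x w y']) auto
  then show ?case by simp
qed

lemma lseg_edge:
  assumes "{x, w, y} \<in> E" "x \<noteq> w" "x \<noteq> y" "w \<noteq> y"
  shows "lseg E 1 x y {x, w, y}"
  using lseg.cons[OF assms(1,2) lseg.nil] assms by simp

lemma lseg_link:
  assumes "lseg E n x y X" "lseg E m z r Z" "{y, w, z} \<in> E" "X \<inter> Z = {}" "w \<notin> X" "w \<notin> Z"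
  shows "lseg E (n + m + 1) x r (X \<union> Z \<union> {w})"
proof -
  have yz: "y \<in> X" "z \<in> Z" using assms lseg_ends by metis+
  have "lseg E (Suc m) y r (insert y (insert w Z))"
    using assms yz by (intro lseg.cons[of y w z]) auto
  then have "lseg E (n + Suc m) x r (X \<union> insert y (insert w Z))"
    using assms yz by (intro lseg_append[OF assms(1)]) auto
  moreover have "X \<union> insert y (insert w Z) = X \<union> Z \<union> {w}" using yz by auto
  ultimately show ?thesis by simp
qed

lemma lseg_rev: "lseg E n x z X \<Longrightarrow> lseg E n z x X"
proof (induction rule: lseg.induct)
  case (nil x)
  then show ?case by (rule lseg.nil)
next
  case (cons x w y n z X)
  have "y \<in> X" using cons lseg_ends by metis
  have "lseg E (n + 0 + 1) z x (X \<union> {x} \<union> {w})"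
    using cons by (intro lseg_link[OF _ lseg.nil, of _ _ _ y]) (auto simp: insert_commute)
  then show ?case by (simp add: insert_commute Un_commute)
qed

lemma lseg_drop_last:
  assumes "lseg E (Suc n) x z X"
  obtains y Y where "lseg E n x y Y" "Y \<subseteq> X" "z \<notin> Y"
proof -
  obtain w y Y where "{z, w, y} \<in> E" "z \<noteq> w" "lseg E n y x Y" "z \<notin> Y" "w \<notin> Y"
    "X = insert z (insert w Y)"
    using lseg_rev[OF assms] by (rule lseg_SucE)
  then show ?thesis using that[of y Y] lseg_rev[of E n y x Y] by blast
qed

text \<open>In the first alternative \<open>r\<close> is an end or a junction; in the second it is
  the free vertex of an edge, and deleting that edge leaves the parts \<open>A\<close> and
  \<open>B\<close>.\<close>

lemma lseg_split:
  assumes "lseg E n x z X" "r \<in> X"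
  shows "(\<exists>i j A B. i + j = n \<and> lseg E i x r A \<and> lseg E j r z B \<and> A \<inter> B = {r} \<and> A \<union> B = X)
    \<or> (\<exists>i j A B y y'. Suc (i + j) = n \<and> lseg E i x y A \<and> lseg E j y' z B \<and> {y, r, y'} \<in> E
         \<and> A \<inter> B = {} \<and> r \<notin> A \<and> r \<notin> B \<and> A \<union> B \<union> {r} = X)"
  using assms
proof (induction rule: lseg.induct)
  case (nil x)
  then show ?case using lseg.nil[of E x]
    by (intro disjI1 exI[of _ 0] exI[of _ "{x}"]) simp
next
  case (cons x w y n z X)
  consider "r = x" | "r = w" | "r \<in> X" using cons.prems by auto
  then show ?case
  proof cases
    case 1
    have "lseg E (Suc n) x z (insert x (insert w X))" using cons.hyps by (intro lseg.cons)
    then have "0 + Suc n = Suc n \<and> lseg E 0 x r {x} \<and> lseg E (Suc n) r z (insert x (insert w X)) \<and>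
      {x} \<inter> insert x (insert w X) = {r} \<and> {x} \<union> insert x (insert w X) = insert x (insert w X)"
      using 1 lseg.nil by auto
    then show ?thesis
      by (intro disjI1 exI[of _ 0] exI[of _ "Suc n"] exI[of _ "{x}"] exI[of _ "insert x (insert w X)"])
  next
    case 2
    then have "Suc (0 + n) = Suc n \<and> lseg E 0 x x {x} \<and> lseg E n y z X \<and> {x, r, y} \<in> E
         \<and> {x} \<inter> X = {} \<and> r \<notin> {x} \<and> r \<notin> X \<and> {x} \<union> X \<union> {r} = insert x (insert w X)"
      using cons.hyps lseg.nil[of E x] 2 by (simp add: insert_commute Un_commute)
    then show ?thesis
      by (intro disjI2 exI[of _ 0] exI[of _ n] exI[of _ "{x}"] exI[of _ X] exI[of _ x] exI[of _ y])
  next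
    case 3
    from cons.IH[OF 3] show ?thesis
    proof (elim disjE exE conjE)
      fix i j A B
      assume h: "i + j = n" "lseg E i y r A" "lseg E j r z B" "A \<inter> B = {r}" "A \<union> B = X"
      have "lseg E (Suc i) x r (insert x (insert w A))"
        using cons h by (intro lseg.cons[of x w y]) auto
      moreover have "insert x (insert w A) \<inter> B = {r}" "insert x (insert w A) \<union> B = insert x (insert w X)"
        using h cons by auto
      moreover have "Suc i + j = Suc n" using h by simp
      ultimately show ?thesis using h(3)
        by (intro disjI1 exI[of _ "Suc i"] exI[of _ j] exI[of _ "insert x (insert w A)"] exI[of _ B]) simp
    next
      fix i j A B y1 y2
      assume h: "Suc (i + j) = n" "lseg E i y y1 A" "lseg E j y2 z B" "{y1, r, y2} \<in> E"
        "A \<inter> B = {}" "r \<notin> A" "r \<notin> B" "A \<union> B \<union> {r} = X"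
      have "lseg E (Suc i) x y1 (insert x (insert w A))"
        using cons h by (intro lseg.cons[of x w y]) auto
      moreover have "insert x (insert w A) \<inter> B = {}" "r \<notin> insert x (insert w A)"
        "insert x (insert w A) \<union> B \<union> {r} = insert x (insert w X)"
        using h cons 3 by auto
      moreover have "Suc (Suc i + j) = Suc n" using h by simp
      ultimately show ?thesis using h(3,4,7)
        by (intro disjI2 exI[of _ "Suc i"] exI[of _ j] exI[of _ "insert x (insert w A)"] exI[of _ B]
            exI[of _ y1] exI[of _ y2]) simp
    qed
  qed
qed

section \<open>Translation between edge lists and inductive paths\<close>

lemma linear_path_Cons:
  assumes "linear_path es" "es \<noteq> [] \<Longrightarrow> card (e \<inter> hd es) = 1" "\<And>f. f \<in> set (tl es) \<Longrightarrow> e \<inter> f = {}"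
  shows "linear_path (e # es)"
  unfolding linear_path_def
proof (intro allI impI)
  fix i j assume ij: "i < j" "j < length (e # es)"
  then obtain j' where j: "j = Suc j'" "j' < length es" by (cases j) auto
  show "if j = i + 1 then card ((e # es) ! i \<inter> (e # es) ! j) = 1
    else (e # es) ! i \<inter> (e # es) ! j = {}"
  proof (cases i)
    case 0
    show ?thesis
    proof (cases j')
      case 0
      then show ?thesis using \<open>i = 0\<close> j assms(2) by (cases es) auto
    next
      case (Suc l)
      then have "es ! j' \<in> set (tl es)" using j by (cases es) auto
      then show ?thesis using \<open>i = 0\<close> j Suc assms(3) by auto
    qed
  next
    case (Suc i')
    then show ?thesis using assms(1) ij j unfolding linear_path_def by auto
  qed
qed

text \<open>The conjuncts about \<open>x\<close> carry the induction: a new first edge meets the old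
  path only in its start, which must lie on the old first edge and on no later one.\<close>

lemma lseg_imp_linear_path:
  assumes "lseg E n x z X"
  shows "\<exists>es. length es = n \<and> set es \<subseteq> E \<and> linear_path es \<and> \<Union>(set es) \<subseteq> X
    \<and> (es \<noteq> [] \<longrightarrow> x \<in> hd es) \<and> x \<notin> \<Union>(set (tl es))"
  using assms
proof (induction rule: lseg.induct)
  case (nil x)
  show ?case by (rule exI[of _ "[]"]) (simp add: linear_path_def)
next
  case (cons x w y n z X)
  then obtain es where es: "length es = n" "set es \<subseteq> E" "linear_path es" "\<Union>(set es) \<subseteq> X"
    "es \<noteq> [] \<longrightarrow> y \<in> hd es" "y \<notin> \<Union>(set (tl es))" by auto
  have yX: "y \<in> X" using cons lseg_ends by metis
  have sub: "{x, w, y} \<inter> f \<subseteq> {y}" if "f \<in> set es" for f using that es(4) cons.hyps by blast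
  have "linear_path ({x, w, y} # es)"
  proof (rule linear_path_Cons[OF es(3)])
    assume "es \<noteq> []"
    then have "{x, w, y} \<inter> hd es = {y}" using sub[of "hd es"] es(5) by auto
    then show "card ({x, w, y} \<inter> hd es) = 1" by simp
  next
    fix f assume f: "f \<in> set (tl es)"
    then have "f \<in> set es" by (metis list.sel(2) list.set_sel(2))
    then show "{x, w, y} \<inter> f = {}" using sub[of f] es(6) f by blast
  qed
  then show ?case using es cons yX by (intro exI[of _ "{x, w, y} # es"]) auto
qed

lemma lseg_contains: "lseg E n x z X \<Longrightarrow> contains_linear_path E n"
  unfolding contains_linear_path_def using lseg_imp_linear_path by meson

lemma contains_linear_path_mono:
  assumes "contains_linear_path E n" "m \<le> n"
  shows "contains_linear_path E m"
proof -
  obtain es where es: "length es = n" "set es \<subseteq> E" "linear_path es"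
    using assms(1) unfolding contains_linear_path_def by auto
  have "length (take m es) = m" "set (take m es) \<subseteq> E"
    using es assms(2) set_take_subset[of m es] by auto
  moreover have "linear_path (take m es)" using es(3) unfolding linear_path_def by auto
  ultimately show ?thesis unfolding contains_linear_path_def by blast
qed

lemma card_3_with:
  assumes "card e = 3" "y \<in> e"
  obtains a b where "e = {y, a, b}" "y \<noteq> a" "y \<noteq> b" "a \<noteq> b"
proof -
  have "card (e - {y}) = 2" using assms by simp
  then obtain a b where "e - {y} = {a, b}" "a \<noteq> b" by (meson card_2_iff)
  then show ?thesis using that[of a b] assms(2) by blast
qed

text \<open>A vertex of the first edge that is off the second can serve as the start; the common
  vertex of the two edges is then the start for the tail of the list.\<close>

lemma linear_path_imp_lseg:
  assumes "linear_path es" "es \<noteq> []" "\<forall>e\<in>set es. e \<in> E \<and> card e = 3"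
    "y \<in> hd es" "tl es \<noteq> [] \<Longrightarrow> y \<notin> hd (tl es)"
  shows "\<exists>z. lseg E (length es) y z (\<Union>(set es))"
  using assms
proof (induction es arbitrary: y)
  case Nil
  then show ?case by simp
next
  case (Cons e es)
  have e: "e \<in> E" "card e = 3" "y \<in> e" using Cons.prems by auto
  show ?case
  proof (cases es)
    case Nil
    obtain a b where ab: "e = {y, a, b}" "y \<noteq> a" "y \<noteq> b" "a \<noteq> b" by (rule card_3_with[OF e(2,3)])
    then show ?thesis using Nil lseg_edge[of y a b E] e by auto
  next
    case (Cons f fs)
    have lp: "linear_path (e # f # fs)" using Cons.prems(1) Cons by simp
    have "card (e \<inter> f) = 1"
      using lp unfolding linear_path_def by (elim allE[of _ 0] allE[of _ 1]) simp
    then obtain y' where y': "e \<inter> f = {y'}" by (meson card_1_singletonE)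
    have dis: "e \<inter> g = {}" if g: "g \<in> set fs" for g
    proof -
      obtain l where l: "l < length fs" "g = fs ! l" using g by (metis in_set_conv_nth)
      have "(e # f # fs) ! 0 \<inter> (e # f # fs) ! (Suc (Suc l)) = {}"
        using lp l(1) unfolding linear_path_def
        by (elim allE[of _ 0] allE[of _ "Suc (Suc l)"]) auto
      then show ?thesis using l by simp
    qed
    have lp': "linear_path es" unfolding linear_path_def
    proof (intro allI impI)
      fix i j assume "i < j" "j < length es"
      then show "if j = i + 1 then card (es ! i \<inter> es ! j) = 1 else es ! i \<inter> es ! j = {}"
        using Cons.prems(1) unfolding linear_path_def
        by (elim allE[of _ "Suc i"] allE[of _ "Suc j"]) auto
    qed
    have "y' \<notin> hd (tl es)" if "tl es \<noteq> []"
    proof -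
      have "hd (tl es) \<in> set fs" using that Cons by simp
      then show ?thesis using dis y' by blast
    qed
    then obtain z where z: "lseg E (length es) y' z (\<Union>(set es))"
      using Cons.IH[OF lp', of y'] Cons.prems(3) Cons y' by auto
    have yy': "y \<noteq> y'" "y \<notin> f" using Cons.prems(5) y' Cons by auto
    obtain a b where ab: "e = {y, a, b}" "y \<noteq> a" "y \<noteq> b" "a \<noteq> b" by (rule card_3_with[OF e(2,3)])
    moreover have "y' \<in> e" using y' by auto
    ultimately consider "y' = a" | "y' = b" using yy' by auto
    then obtain w where w: "e = {y, w, y'}" "y \<noteq> w" "w \<noteq> y'"
    proof cases
      case 1
      show ?thesis by (rule that[of b]) (use 1 ab in auto)
    next
      case 2
      show ?thesis by (rule that[of a]) (use 2 ab in auto)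
    qed
    have "e \<inter> \<Union>(set es) = {y'}" using y' dis Cons by auto
    moreover have "y \<in> e" "w \<in> e" using w by auto
    ultimately have "y \<notin> \<Union>(set es)" "w \<notin> \<Union>(set es)" using w(3) yy'(1) by blast+
    then have "lseg E (Suc (length es)) y z (insert y (insert w (\<Union>(set es))))"
      using w e z by (intro lseg.cons[of y w y']) auto
    moreover have "insert y (insert w (\<Union>(set es))) = \<Union>(set (e # es))"
      using w lseg_ends[OF z] by auto
    ultimately show ?thesis by auto
  qed
qed

section \<open>Paths labelled by positions\<close>

text \<open>Edge number \<open>i\<close> (from 0) has junctions \<open>p (2 * i)\<close>, \<open>p (2 * i + 2)\<close> and the free vertex
  \<open>p (2 * i + 1)\<close>; so \<open>p 0\<close> and \<open>p 1\<close> play the same role, as do \<open>p (2 * k)\<close> and \<open>p (2 * k - 1)\<close>.\<close>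

definition vpath :: "'a set set \<Rightarrow> nat \<Rightarrow> (nat \<Rightarrow> 'a) \<Rightarrow> bool" where
  "vpath E k p \<longleftrightarrow> inj_on p {..2 * k} \<and> (\<forall>i<k. {p (2 * i), p (2 * i + 1), p (2 * i + 2)} \<in> E)"

lemma vpath_eq_iff:
  "vpath E k p \<Longrightarrow> r \<le> 2 * k \<Longrightarrow> s \<le> 2 * k \<Longrightarrow> p r = p s \<longleftrightarrow> r = s"
  using inj_on_eq_iff[of p "{..2 * k}" r s] by (simp add: vpath_def)

lemma vpath_notin:
  assumes "vpath E k p" "r \<le> 2 * k" "A \<subseteq> {..2 * k}" "r \<notin> A"
  shows "p r \<notin> p ` A"
  using assms inj_on_image_mem_iff[of p "{..2 * k}" r A] by (simp add: vpath_def)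

lemma lseg_imp_vpath:
  assumes "lseg E n x z X"
  shows "\<exists>p. vpath E n p \<and> p ` {..2 * n} = X \<and> p 0 = x"
  using assms
proof (induction rule: lseg.induct)
  case (nil x)
  show ?case by (rule exI[of _ "\<lambda>_. x"]) (simp add: vpath_def)
next
  case (cons x w y n z X)
  from cons.IH obtain p where p: "vpath E n p" "p ` {..2 * n} = X" "p 0 = y" by blast
  define q where "q s = (if s = 0 then x else if s = 1 then w else p (s - 2))" for s
  have set: "{..2 * Suc n} = insert 0 (insert 1 ((\<lambda>s. s + 2) ` {..2 * n}))" (is "_ = ?R")
  proof -
    have "s \<in> ?R" if "s \<le> 2 * n + 2" for s
    proof (cases "s \<le> 1")
      case True then show ?thesis by auto
    next
      case False
      then have "s = (s - 2) + 2" "s - 2 \<in> {..2 * n}" using that by auto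
      then show ?thesis by blast
    qed
    then show ?thesis by auto
  qed
  have q0: "q 0 = x" by (simp add: q_def)
  have q2: "q (s + 2) = p s" for s by (simp add: q_def)
  have img: "q ` {..2 * Suc n} = insert x (insert w X)"
    unfolding set image_insert image_image q2 p(2) by (simp add: q_def)
  \<comment> \<open>Injectivity is obtained by counting: the image of the \<open>2 * n + 3\<close>
    positions has \<open>2 * n + 3\<close> elements.\<close>
  have "finite X" "card X = 2 * n + 1" using lseg_card[OF cons.hyps(3)] by auto
  then have "card (q ` {..2 * Suc n}) = card {..2 * Suc n}" unfolding img using cons.hyps by simp
  then have "inj_on q {..2 * Suc n}" by (intro eq_card_imp_inj_on) auto
  moreover have "{q (2 * i), q (2 * i + 1), q (2 * i + 2)} \<in> E" if "i < Suc n" for i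
  proof (cases i)
    case 0
    then show ?thesis using cons.hyps(1) p(3) by (simp add: q_def)
  next
    case (Suc j)
    then show ?thesis using p(1) that unfolding vpath_def by (auto simp: q_def)
  qed
  ultimately have "vpath E (Suc n) q" by (simp add: vpath_def)
  then show ?case using img q0 by blast
qed

lemma contains_imp_vpath:
  assumes "contains_linear_path E k" "k \<ge> 1" "\<forall>e\<in>E. card e = 3"
  obtains p where "vpath E k p"
proof -
  obtain es where es: "length es = k" "set es \<subseteq> E" "linear_path es"
    using assms(1) unfolding contains_linear_path_def by auto
  have ne: "es \<noteq> []" using es assms by auto
  \<comment> \<open>The first edge has three vertices and shares only one with the second, so a
    start vertex exists.\<close>
  have "\<exists>y\<in>hd es. tl es \<noteq> [] \<longrightarrow> y \<notin> hd (tl es)"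
  proof (cases "tl es = []")
    case True
    have "hd es \<in> E" using es(2) ne hd_in_set by blast
    then have "card (hd es) = 3" using assms(3) by auto
    then have "hd es \<noteq> {}" by auto
    then show ?thesis using True by auto
  next
    case False
    then obtain e f fs where eq: "es = e # f # fs" by (metis list.exhaust_sel ne)
    have "card (e \<inter> f) = 1"
      using es(3) unfolding eq linear_path_def by (elim allE[of _ 0] allE[of _ 1]) simp
    moreover have "card e = 3" using eq es assms(3) by auto
    ultimately have "\<not> e \<subseteq> f" by (metis Int_absorb2 numeral_eq_one_iff semiring_norm(86))
    then show ?thesis using eq by auto
  qed
  then obtain y where y: "y \<in> hd es" "tl es \<noteq> [] \<Longrightarrow> y \<notin> hd (tl es)" by blast
  have "\<forall>e\<in>set es. e \<in> E \<and> card e = 3" using es(2) assms(3) by blast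
  from linear_path_imp_lseg[OF es(3) ne this y] obtain z where
    "lseg E (length es) y z (\<Union>(set es))" by blast
  from lseg_imp_vpath[OF this] show ?thesis using that es(1) by blast
qed

lemma vpath_lseg_from:
  assumes "vpath E k p" "i \<le> j" "j \<le> k" "s = 2 * i \<or> s = 2 * i + 1 \<and> i < j"
  shows "lseg E (j - i) (p s) (p (2 * j)) (p ` {2 * i..2 * j})"
  using assms(2,4)
proof (induction "j - i" arbitrary: i s)
  case 0
  then show ?case using lseg.nil[of E "p (2 * j)"] by auto
next
  case (Suc n)
  then have lt: "i < j" by simp
  have rest: "lseg E (j - Suc i) (p (2 * Suc i)) (p (2 * j)) (p ` {2 * Suc i..2 * j})"
    using Suc.hyps(2) lt by (intro Suc.hyps(1)) auto
  have e: "{p (2 * i), p (2 * i + 1), p (2 * i + 2)} \<in> E"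
    using assms lt by (auto simp: vpath_def)
  have notin: "p r \<notin> p ` {2 * Suc i..2 * j}" if "r < 2 * Suc i" for r
    using that assms(3) lt by (intro vpath_notin[OF assms(1)]) auto
  have ne: "p (2 * i) \<noteq> p (2 * i + 1)" using vpath_eq_iff[OF assms(1)] lt assms(3) by simp
  have set: "{2 * i..2 * j} = insert (2 * i) (insert (2 * i + 1) {2 * Suc i..2 * j})" using lt by auto
  have "lseg E (Suc (j - Suc i)) (p (2 * i)) (p (2 * j)) (p ` {2 * i..2 * j})"
    unfolding set image_insert using e ne notin rest by (intro lseg.cons) auto
  moreover have "lseg E (Suc (j - Suc i)) (p (2 * i + 1)) (p (2 * j)) (p ` {2 * i..2 * j})"
    unfolding set image_insert insert_commute[of "p (2 * i)"]
    using e ne notin rest by (intro lseg.cons) (auto simp: insert_commute)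
  moreover have "Suc (j - Suc i) = j - i" using lt by simp
  ultimately show ?case using Suc.prems(2) by auto
qed

lemma vpath_rev:
  assumes "vpath E k p"
  shows "vpath E k (\<lambda>s. p (2 * k - s))"
  unfolding vpath_def
proof (intro conjI allI impI)
  have "inj_on p ((\<lambda>s. 2 * k - s) ` {..2 * k})"
    using assms unfolding vpath_def by (auto intro: inj_on_subset)
  moreover have "inj_on (\<lambda>s. 2 * k - s) {..2 * k}" by (auto simp: inj_on_def)
  ultimately show "inj_on (\<lambda>s. p (2 * k - s)) {..2 * k}"
    using comp_inj_on[of "\<lambda>s. 2 * k - s" "{..2 * k}" p] by (simp add: comp_def)
next
  fix i assume "i < k"
  then have "{p (2 * (k - 1 - i)), p (2 * (k - 1 - i) + 1), p (2 * (k - 1 - i) + 2)} \<in> E"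
    using assms unfolding vpath_def by auto
  moreover have "2 * (k - 1 - i) = 2 * k - (2 * i + 2)" "2 * (k - 1 - i) + 1 = 2 * k - (2 * i + 1)"
    "2 * (k - 1 - i) + 2 = 2 * k - 2 * i" using \<open>i < k\<close> by auto
  ultimately show "{p (2 * k - 2 * i), p (2 * k - (2 * i + 1)), p (2 * k - (2 * i + 2))} \<in> E"
    by (simp add: insert_commute)
qed

lemma vpath_swap:
  assumes "vpath E k p" "k \<ge> 1"
  shows "vpath E k (p(0 := p 1, 1 := p 0))" (is "vpath E k ?q")
  unfolding vpath_def
proof (intro conjI allI impI)
  show "inj_on ?q {..2 * k}"
  proof (rule inj_onI)
    fix r s assume "r \<in> {..2 * k}" "s \<in> {..2 * k}" "?q r = ?q s"
    then show "r = s" using vpath_eq_iff[OF assms(1)] assms(2) by (auto split: if_splits)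
  qed
next
  fix i assume "i < k"
  then have "{p (2 * i), p (2 * i + 1), p (2 * i + 2)} \<in> E" using assms(1) by (simp add: vpath_def)
  then show "{?q (2 * i), ?q (2 * i + 1), ?q (2 * i + 2)} \<in> E"
    by (cases "i = 0") (auto simp: insert_commute)
qed

lemma swap_image:
  fixes p :: "nat \<Rightarrow> 'a"
  assumes "k \<ge> 1"
  shows "(p(0 := p 1, 1 := p 0)) ` {..2 * k} = p ` {..2 * k}"
proof -
  have "{..2 * k} = insert 0 (insert 1 {2..2 * k})" using assms by auto
  then show ?thesis by auto
qed

lemma rev_image:
  fixes p :: "nat \<Rightarrow> 'a"
  shows "(\<lambda>s. p (2 * k - s)) ` {..2 * k} = p ` {..2 * k}"
proof -
  have "(\<lambda>s. 2 * k - s) ` {..2 * k} = {..2 * k}"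
  proof (intro equalityI subsetI)
    fix s assume "s \<in> {..2 * k}"
    then show "s \<in> (\<lambda>s. 2 * k - s) ` {..2 * k}" by (intro image_eqI[of _ _ "2 * k - s"]) auto
  qed auto
  then have "p ` (\<lambda>s. 2 * k - s) ` {..2 * k} = p ` {..2 * k}" by simp
  then show ?thesis by (simp only: image_image)
qed

text \<open>At either end the junction and the free vertex of the end edge are interchangeable. In a
  segment of one edge both choices could be the free vertex; the last hypothesis excludes
  this.\<close>

lemma vpath_lseg:
  assumes "vpath E k p" "i \<le> j" "j \<le> k" "s \<in> {2 * i..2 * j}" "s \<le> 2 * i + 1"
    "r \<in> {2 * i..2 * j}" "2 * j \<le> r + 1" "s = r \<Longrightarrow> i = j"
  shows "lseg E (j - i) (p s) (p r) (p ` {2 * i..2 * j})"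
proof (cases "r = 2 * j")
  case True
  have "s = 2 * i \<or> s = 2 * i + 1 \<and> i < j" using assms by auto
  then show ?thesis using vpath_lseg_from[OF assms(1-3)] True by simp
next
  case False
  then have r: "r = 2 * j - 1" "i < j" using assms by auto
  obtain j' where j': "j = Suc j'" using r by (cases j) auto
  have "s = 2 * i \<or> s = 2 * i + 1 \<and> i < j'"
  proof (cases "s = 2 * i")
    case False
    then have "s = 2 * i + 1" using assms(4,5) by auto
    moreover have "i \<noteq> j'" using assms(8) r j' calculation by auto
    ultimately show ?thesis using r j' by auto
  qed simp
  then have L: "lseg E (j' - i) (p s) (p (2 * j')) (p ` {2 * i..2 * j'})"
    using vpath_lseg_from[OF assms(1), of i j' s] r j' assms(3) by auto
  have e: "{p (2 * j'), p (2 * j' + 2), p (2 * j' + 1)} \<in> E"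
    using assms(1,3) j' by (auto simp: vpath_def insert_commute)
  have notin: "p l \<notin> p ` {2 * i..2 * j'}" if "2 * j' < l" "l \<le> 2 * k" for l
    using that by (intro vpath_notin[OF assms(1)]) auto
  have ne: "p (2 * j' + 2) \<noteq> p (2 * j' + 1)" using vpath_eq_iff[OF assms(1)] assms(3) j' by simp
  have "lseg E (j' - i + 0 + 1) (p s) (p (2 * j' + 1))
      (p ` {2 * i..2 * j'} \<union> {p (2 * j' + 1)} \<union> {p (2 * j' + 2)})"
    using notin ne assms(3) j' by (intro lseg_link[OF L lseg.nil e]) auto
  moreover have "{2 * i..2 * j} = insert (2 * j' + 1) (insert (2 * j' + 2) {2 * i..2 * j'})"
    using j' r by auto
  moreover have "j' - i + 0 + 1 = j - i" "r = 2 * j' + 1" using j' r by auto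
  ultimately show ?thesis by (simp add: insert_commute)
qed

section \<open>Closed paths\<close>

text \<open>The edge through \<open>w\<close> closes the path to a cycle of \<open>k + 1\<close>
  edges. Dropping one edge next to \<open>z\<close> opens it to a path of \<open>k\<close> edges
  that starts at \<open>z\<close>.\<close>

lemma cycle_path:
  assumes L: "lseg E k a x X" and k: "k \<ge> 1" and e: "{x, w, a} \<in> E" and w: "w \<notin> X"
    and z: "z \<in> insert w X"
  shows "\<exists>y Y. lseg E k z y Y \<and> Y \<subseteq> insert w X"
proof (cases "z = w")
  case True
  obtain k' where k': "k = Suc k'" using k by (cases k) auto
  obtain w' y Y where Y: "{a, w', y} \<in> E" "a \<noteq> w'" "lseg E k' y x Y" "a \<notin> Y" "w' \<notin> Y"
    "X = insert a (insert w' Y)"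
    using L unfolding k' by (rule lseg_SucE)
  \<comment> \<open>The closing edge is traversed from \<open>w\<close> to \<open>x\<close> with
    \<open>a\<close> as its free vertex, and the first edge of the path is dropped.\<close>
  have "lseg E (Suc k') w y (insert w (insert a Y))"
    using e w Y lseg_rev[OF Y(3)] by (intro lseg.cons[of w a x]) (auto simp: insert_commute)
  moreover have "insert w (insert a Y) \<subseteq> insert w X" using Y by auto
  ultimately show ?thesis using True k' by blast
next
  case False
  then have "z \<in> X" using z by simp
  from lseg_split[OF L this] show ?thesis
  proof (elim disjE exE conjE)
    fix i j A B
    assume h: "i + j = k" "lseg E i a z A" "lseg E j z x B" "A \<inter> B = {z}" "A \<union> B = X"
    show ?thesis
    proof (cases i)
      case 0
      then show ?thesis using h by auto
    next
      case (Suc i')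
      obtain y A' where A': "lseg E i' a y A'" "A' \<subseteq> A" "z \<notin> A'"
        using h(2) unfolding Suc by (rule lseg_drop_last)
      have "lseg E (j + i' + 1) z y (B \<union> A' \<union> {w})"
        using e w h A' by (intro lseg_link[OF h(3) A'(1)]) auto
      moreover have k: "j + i' + 1 = k" using h Suc by simp
      moreover have "B \<union> A' \<union> {w} \<subseteq> insert w X" using h A' by auto
      ultimately show ?thesis unfolding k by (intro exI conjI)
    qed
  next
    fix i j A B y1 y2
    assume h: "Suc (i + j) = k" "lseg E i a y1 A" "lseg E j y2 x B" "{y1, z, y2} \<in> E"
      "A \<inter> B = {}" "z \<notin> A" "z \<notin> B" "A \<union> B \<union> {z} = X"
    have y1: "y1 \<in> A" using h lseg_ends by metis
    \<comment> \<open>The edge of \<open>z\<close> is traversed towards \<open>y2\<close>, so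
      \<open>y1\<close> becomes its free vertex and \<open>A\<close> has to give up its last
      edge.\<close>
    have C: "lseg E (Suc j) z x (insert z (insert y1 B))"
      using h y1 by (intro lseg.cons[of z y1 y2]) (auto simp: insert_commute)
    show ?thesis
    proof (cases i)
      case 0
      have "insert z (insert y1 B) \<subseteq> insert w X" using h y1 by auto
      moreover have "Suc j = k" using 0 h by simp
      ultimately show ?thesis using C by blast
    next
      case (Suc i')
      obtain y A' where A': "lseg E i' a y A'" "A' \<subseteq> A" "y1 \<notin> A'"
        using h(2) unfolding Suc by (rule lseg_drop_last)
      have "lseg E (Suc j + i' + 1) z y (insert z (insert y1 B) \<union> A' \<union> {w})"
        using e w h A' y1 by (intro lseg_link[OF C A'(1)]) auto
      moreover have k: "Suc j + i' + 1 = k" using h Suc by simp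
      moreover have "insert z (insert y1 B) \<union> A' \<union> {w} \<subseteq> insert w X" using h A' y1 by auto
      ultimately show ?thesis unfolding k by (intro exI conjI)
    qed
  qed
qed

text \<open>Open the cycle at \<open>z\<close> and put \<open>h\<close> in front.\<close>

lemma cycle_attach:
  assumes "lseg E k a x X" "k \<ge> 1" "{x, w, a} \<in> E" "w \<notin> X"
    and h: "h \<in> E" "card h = 3" "h \<inter> insert w X = {z}"
  shows "contains_linear_path E (Suc k)"
proof -
  obtain y Y where Y: "lseg E k z y Y" "Y \<subseteq> insert w X"
    using cycle_path[OF assms(1-4), of z] h by auto
  have z: "z \<in> h" using h by auto
  obtain p q where pq: "h = {z, p, q}" "z \<noteq> p" "z \<noteq> q" "p \<noteq> q"
    by (rule card_3_with[OF h(2) z])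
  have "{z, p, q} \<inter> insert w X = {z}" using h(3) pq(1) by simp
  then have "p \<notin> insert w X" "q \<notin> insert w X" using pq(2,3) by auto
  then have "lseg E (Suc k) p y (insert p (insert q Y))"
    using Y pq h by (intro lseg.cons[of p q z]) (auto simp: insert_commute)
  then show ?thesis by (rule lseg_contains)
qed

section \<open>Assembling paths from segments and outside vertices\<close>

text \<open>Linear paths assembled from the positions \<open>A\<close> on \<open>p\<close> and outside vertices \<open>U\<close>: disjointness
  of pieces becomes disjointness of sets of numbers.\<close>

definition sgm :: "'a set set \<Rightarrow> nat \<Rightarrow> (nat \<Rightarrow> 'a) \<Rightarrow> nat \<Rightarrow> 'a \<Rightarrow> 'a \<Rightarrow> nat set \<Rightarrow> 'a set \<Rightarrow> bool" where
  "sgm E k p n x y A U \<longleftrightarrow> A \<subseteq> {..2 * k} \<and> U \<inter> p ` {..2 * k} = {} \<and>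
     (\<exists>X. lseg E n x y X \<and> X \<subseteq> p ` A \<union> U)"

definition outs :: "'a set set \<Rightarrow> nat \<Rightarrow> (nat \<Rightarrow> 'a) \<Rightarrow> 'a \<Rightarrow> 'a \<Rightarrow> 'a set" where
  "outs E k p x y = {w. w \<notin> p ` {..2 * k} \<and> {x, y, w} \<in> E}"

lemma outs_edge:
  assumes "w \<in> outs E k p x y"
  shows "w \<notin> p ` {..2 * k}" "{x, w, y} \<in> E" "{y, w, x} \<in> E"
  using assms by (auto simp: outs_def insert_commute)

lemma sgm_point: "s \<le> 2 * k \<Longrightarrow> sgm E k p 0 (p s) (p s) {s} {}"
  unfolding sgm_def using lseg.nil[of E "p s"] by auto

lemma sgm_rev: "sgm E k p n x y A U \<Longrightarrow> sgm E k p n y x A U"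
  unfolding sgm_def using lseg_rev by metis

lemma sgm_contains: "sgm E k p n x y A U \<Longrightarrow> contains_linear_path E n"
  unfolding sgm_def using lseg_contains by metis

lemma sgm_link:
  assumes p: "vpath E k p" and x: "sgm E k p n x y A U" and z: "sgm E k p m z r B U'"
    and w: "{y, w, z} \<in> E" "w \<notin> p ` {..2 * k}" "w \<notin> U" "w \<notin> U'"
    and d: "A \<inter> B = {}" "U \<inter> U' = {}"
  shows "sgm E k p (n + m + 1) x r (A \<union> B) (insert w (U \<union> U'))"
proof -
  obtain X Z where X: "lseg E n x y X" "X \<subseteq> p ` A \<union> U" and Z: "lseg E m z r Z" "Z \<subseteq> p ` B \<union> U'"
    using x z unfolding sgm_def by auto
  have A: "A \<subseteq> {..2 * k}" "U \<inter> p ` {..2 * k} = {}" and B: "B \<subseteq> {..2 * k}" "U' \<inter> p ` {..2 * k} = {}"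
    using x z unfolding sgm_def by auto
  have AB: "p ` A \<inter> p ` B = {}" using p A(1) B(1) d(1) inj_on_image_Int[of p "{..2 * k}" A B]
    by (simp add: vpath_def)
  have sub: "p ` A \<subseteq> p ` {..2 * k}" "p ` B \<subseteq> p ` {..2 * k}" using A B by auto
  have "p ` A \<inter> U' = {}" "U \<inter> p ` B = {}"
    using Int_mono[OF sub(1) subset_refl, of U'] Int_mono[OF subset_refl sub(2), of U] A(2) B(2)
    by (simp_all add: Int_commute)
  then have "(p ` A \<union> U) \<inter> (p ` B \<union> U') = {}" using AB d(2) by (simp add: Int_Un_distrib Int_Un_distrib2)
  then have "X \<inter> Z = {}" using Int_mono[OF X(2) Z(2)] by simp
  moreover have "w \<notin> X"
    by (rule contra_subsetD[OF order_trans[OF X(2) Un_mono[OF sub(1) subset_refl]]]) (simp add: w)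
  moreover have "w \<notin> Z"
    by (rule contra_subsetD[OF order_trans[OF Z(2) Un_mono[OF sub(2) subset_refl]]]) (simp add: w)
  ultimately have "lseg E (n + m + 1) x r (X \<union> Z \<union> {w})"
    using X(1) Z(1) w(1) by (intro lseg_link)
  moreover have "X \<union> Z \<union> {w} \<subseteq> p ` (A \<union> B) \<union> insert w (U \<union> U')"
    using X(2) Z(2) unfolding image_Un by auto
  moreover have "A \<union> B \<subseteq> {..2 * k}" using A B by simp
  moreover have "insert w (U \<union> U') \<inter> p ` {..2 * k} = {}" using A(2) B(2) w(2) by (simp add: Int_Un_distrib2)
  ultimately show ?thesis unfolding sgm_def by (intro conjI exI)
qed

lemma sgm_seg:
  assumes "vpath E k p" "i \<le> j" "j \<le> k" "s \<in> {2 * i..2 * j}" "s \<le> 2 * i + 1"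
    "r \<in> {2 * i..2 * j}" "2 * j \<le> r + 1" "s = r \<Longrightarrow> i = j"
  shows "sgm E k p (j - i) (p s) (p r) {2 * i..2 * j} {}"
  unfolding sgm_def using vpath_lseg[OF assms] assms(3) by auto

lemma avoid:
  assumes "card S < card D" "finite S"
  obtains w where "w \<in> D" "w \<notin> S"
  using assms by (metis card_mono leD subsetI)

section \<open>A longest path and the vertices outside it\<close>

text \<open>The assumption \<open>degree\<close> is twice the bound of the theorem at
  \<open>t = k + 1\<close> and \<open>n = m + 2 * k + 1\<close>, with the negative term moved to the
  other side.\<close>

locale no_longer_path =
  fixes V :: "'a set" and E :: "'a set set" and k m :: nat
  assumes tg: "three_graph V E" and no_path: "\<not> contains_linear_path E (Suc k)"
    and k: "2 \<le> k" and m: "18 \<le> m" and card_V: "card V = m + 2 * k + 1"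
    and degree: "v \<in> V \<Longrightarrow> k * m + 5 * k\<^sup>2 + 6 \<le> 2 * vertex_degree E v + 2 * k"
begin

abbreviation "outp \<equiv> outs E k"
abbreviation "sg \<equiv> sgm E k"

lemma edgeD: "e \<in> E \<Longrightarrow> e \<subseteq> V" "e \<in> E \<Longrightarrow> card e = 3" and finite_V: "finite V"
  using tg by (auto simp: three_graph_def)

lemma no_seg: "sg p n x y A U \<Longrightarrow> n \<le> k"
  using sgm_contains[of E k p n x y A U] contains_linear_path_mono[of E n "Suc k"] no_path
  by (metis not_less_eq_eq)

lemma finite_outs: "finite (outp p x y)"
  by (rule finite_subset[OF _ finite_V]) (use edgeD(1) in \<open>auto simp: outs_def\<close>)

text \<open>Such an edge consists of \<open>v\<close> and a pair from \<open>C\<close>, so it is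
  determined by the pair.\<close>

lemma degree_le_pairs:
  assumes C: "finite C" and h: "\<And>h. h \<in> E \<Longrightarrow> v \<in> h \<Longrightarrow> 2 \<le> card (h \<inter> C)" and v: "v \<notin> C"
  shows "vertex_degree E v \<le> card C choose 2"
proof -
  have "{e \<in> E. v \<in> e} \<subseteq> insert v ` {B. B \<subseteq> C \<and> card B = 2}"
  proof
    fix e assume "e \<in> {e \<in> E. v \<in> e}"
    then have e: "e \<in> E" "v \<in> e" "card e = 3" using edgeD by auto
    then have fin: "finite e" using card.infinite by fastforce
    have "e \<inter> C \<subseteq> e - {v}" using v by auto
    moreover have "card (e - {v}) = 2" using e fin by simp
    ultimately have "e \<inter> C = e - {v}" using h[OF e(1,2)] fin
      by (intro card_seteq) auto
    then have "e = insert v (e \<inter> C)" "card (e \<inter> C) = 2" using e \<open>card (e - {v}) = 2\<close> by auto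
    then show "e \<in> insert v ` {B. B \<subseteq> C \<and> card B = 2}" by blast
  qed
  then have "card {e \<in> E. v \<in> e} \<le> card (insert v ` {B. B \<subseteq> C \<and> card B = 2})"
    using C by (intro card_mono) auto
  also have "\<dots> \<le> card {B. B \<subseteq> C \<and> card B = 2}" using C by (intro card_image_le) auto
  also have "\<dots> = card C choose 2" using n_subsets[OF C] by simp
  finally show ?thesis by (simp add: vertex_degree_def)
qed

text \<open>An edge at \<open>w2\<close> leaving the cycle through \<open>w1\<close> meets either that cycle or the cycle through
  \<open>w2\<close> in exactly one vertex.\<close>

lemma cycle_two:
  assumes L: "lseg E k a x X" and w: "w1 \<noteq> w2" "w1 \<notin> X" "w2 \<notin> X"
    and e: "{x, w1, a} \<in> E" "{x, w2, a} \<in> E"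
  shows False
proof -
  let ?C = "insert w1 X"
  have C: "finite ?C" "card ?C = 2 * k + 2" using lseg_card[OF L] w by auto
  \<comment> \<open>Otherwise \<open>w2\<close> has degree at most
    \<open>(k + 1) * (2 * k + 1)\<close>, the number of pairs on the cycle; this is below the degree
    bound because \<open>m\<close> is at least 18.\<close>
  have "\<exists>h\<in>E. w2 \<in> h \<and> card (h \<inter> ?C) < 2"
  proof (rule ccontr)
    assume "\<not> (\<exists>h\<in>E. w2 \<in> h \<and> card (h \<inter> ?C) < 2)"
    then have "vertex_degree E w2 \<le> (2 * k + 2) choose 2"
      using degree_le_pairs[OF C(1), of w2] C(2) w by force
    moreover have "(2 * k + 2) choose 2 = (k + 1) * (2 * k + 1)" by (simp add: choose_two)
    moreover have "w2 \<in> V" using e edgeD by blast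
    ultimately have "k * m + 5 * k\<^sup>2 + 6 \<le> 2 * ((k + 1) * (2 * k + 1)) + 2 * k"
      using degree[of w2] by linarith
    moreover have "k * 18 \<le> k * m" using m by simp
    ultimately show False by (simp add: power2_eq_square algebra_simps)
  qed
  then obtain h where h: "h \<in> E" "w2 \<in> h" "card (h \<inter> ?C) < 2" by blast
  have k1: "k \<ge> 1" using k by simp
  show False
  proof (cases "card (h \<inter> ?C) = 0")
    case True
    then have "h \<inter> ?C = {}" using C by simp
    then have "h \<inter> insert w2 X = {w2}" using h by auto
    then show False using cycle_attach[OF L k1 e(2) w(3) h(1)] h edgeD no_path by auto
  next
    case False
    then obtain z where "h \<inter> ?C = {z}" using h by (metis One_nat_def card_1_singletonE less_2_cases)
    then show False using cycle_attach[OF L k1 e(1) w(2) h(1)] h edgeD no_path by auto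
  qed
qed

lemma cycle_two':
  assumes p: "sg p k a x A U" and D: "card (outp p a x - U) \<ge> 2"
  shows False
proof -
  obtain X where X: "lseg E k a x X" "X \<subseteq> p ` A \<union> U" "A \<subseteq> {..2 * k}" using p by (auto simp: sgm_def)
  obtain w1 where w1: "w1 \<in> outp p a x - U" using D by (metis all_not_in_conv card.empty not_numeral_le_zero)
  obtain w2 where w2: "w2 \<in> outp p a x - U" "w2 \<noteq> w1"
    using avoid[of "{w1}" "outp p a x - U"] D by auto
  have XU: "X \<subseteq> p ` {..2 * k} \<union> U" by (rule order_trans[OF X(2)]) (use X(3) in auto)
  have "w1 \<notin> X" by (rule contra_subsetD[OF XU]) (use w1 outs_edge(1)[of w1 E k p a x] in simp)
  moreover have "w2 \<notin> X" by (rule contra_subsetD[OF XU]) (use w2 outs_edge(1)[of w2 E k p a x] in simp)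
  moreover have "{x, w1, a} \<in> E" "{x, w2, a} \<in> E" using w1 w2 outs_edge(3) by auto
  ultimately show False using cycle_two[OF X(1), of w1 w2] w2 by blast
qed

section \<open>Configurations that a longest path excludes\<close>

context
  fixes p :: "nat \<Rightarrow> 'a" assumes p: "vpath E k p"
begin

abbreviation "d x s \<equiv> card (outp p (p x) (p s))"

lemma left_seg:
  assumes "i < k" "y \<le> 2 * i" "2 * i \<le> y + 1"
  shows "sg p i (p 0) (p y) {0..2 * i} {}"
  using sgm_seg[OF p, of 0 i 0 y] assms by auto

lemma right_seg:
  assumes "i < k" "2 * i + 2 \<le> x" "x \<le> 2 * i + 3" "x \<le> 2 * k"
  shows "sg p (k - Suc i) (p x) (p (2 * k)) {2 * i + 2..2 * k} {}"
  using sgm_seg[OF p, of "Suc i" k x "2 * k"] assms by auto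

text \<open>Delete edge \<open>i\<close>. The new edges at \<open>p 0\<close> and
  \<open>p (2 * k)\<close> reconnect the two remaining parts, as in Dirac's rotation. If one of them
  picks up the free vertex \<open>p (2 * i + 1)\<close>, the result is a path of
  \<open>k + 1\<close> edges; otherwise it is a cycle of that length.\<close>

lemma conflict:
  assumes i: "i < k" and s: "2 * i + 1 \<le> s" "s \<le> 2 * i + 3" "s \<le> 2 * k"
    and r: "2 * i \<le> r + 1" "r \<le> 2 * i + 1" and D: "d 0 s \<ge> 3" "outp p (p (2 * k)) (p r) \<noteq> {}"
  shows False
proof -
  obtain w' where w': "w' \<in> outp p (p (2 * k)) (p r)" using D by auto
  note e' = outs_edge[OF w']
  obtain w where w: "w \<in> outp p (p 0) (p s)" "w \<noteq> w'"
    using avoid[of "{w'}" "outp p (p 0) (p s)"] D by auto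
  note e = outs_edge[OF w(1)]
  have len: "i + (k - Suc i) + 1 = k" using i by simp
  have L: "sg p i (p 0) (p y) {0..2 * i} {}" if "y \<le> 2 * i" "2 * i \<le> y + 1" for y
    using left_seg i that by simp
  have R: "sg p (k - Suc i) (p (2 * k)) (p x) {2 * i + 2..2 * k} {}"
    if "2 * i + 2 \<le> x" "x \<le> 2 * i + 3" "x \<le> 2 * k" for x
    by (rule sgm_rev[OF right_seg]) (use i that in auto)
  show False
  proof (cases "s = 2 * i + 1")
    case s1: True
    have R': "sg p (k - Suc i) (p (2 * k)) (p (2 * i + 2)) {2 * i + 2..2 * k} {}" using R i by simp
    show False
    proof (cases "r = 2 * i + 1")
      case True
      \<comment> \<open>Route: \<open>p (2 * i)\<close> back to \<open>p 0\<close>, via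
        \<open>w\<close> to the free vertex, via \<open>w'\<close> to \<open>p (2 * k)\<close> and
        back to \<open>p (2 * i + 2)\<close>.\<close>
      have "sg p (i + 0 + 1) (p (2 * i)) (p s) ({0..2 * i} \<union> {s}) (insert w ({} \<union> {}))"
        using e s1 s by (intro sgm_link[OF p sgm_rev[OF L] sgm_point]) auto
      note S = this
    have "i + 0 + 1 + (k - Suc i) + 1 \<le> k"
      by (rule no_seg[OF sgm_link[OF p S R', of w']]) (use e' w True s1 in auto)
      then show False using len by simp
    next
      case False
      \<comment> \<open>Route: free vertex, via \<open>w\<close> to \<open>p 0\<close>, along to
        \<open>p r\<close>, via \<open>w'\<close> to \<open>p (2 * k)\<close> and back to
        \<open>p (2 * i + 2)\<close>.\<close>
      have "sg p (0 + i + 1) (p s) (p r) ({s} \<union> {0..2 * i}) (insert w ({} \<union> {}))"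
        using e s1 s r False by (intro sgm_link[OF p sgm_point L]) auto
      note S = this
    have "0 + i + 1 + (k - Suc i) + 1 \<le> k"
      by (rule no_seg[OF sgm_link[OF p S R', of w']]) (use e' w s1 in auto)
      then show False using len by simp
    qed
  next
    case s2: False
    show False
    proof (cases "r = 2 * i + 1")
      case True
      have L': "sg p i (p 0) (p (2 * i)) {0..2 * i} {}" using L by simp
      \<comment> \<open>Route: free vertex, via \<open>w'\<close> to \<open>p (2 * k)\<close>, back
        to \<open>p s\<close>, via \<open>w\<close> to \<open>p 0\<close> and along to
        \<open>p (2 * i)\<close>.\<close>
      have "sg p (0 + (k - Suc i) + 1) (p r) (p s) ({r} \<union> {2 * i + 2..2 * k}) (insert w' ({} \<union> {}))"
        using e' s s2 i True by (intro sgm_link[OF p sgm_point R]) auto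
      note S = this
    have "0 + (k - Suc i) + 1 + i + 1 \<le> k"
      by (rule no_seg[OF sgm_link[OF p S L', of w]]) (use e w True in auto)
      then show False using len by simp
    next
      case False
      \<comment> \<open>This path of \<open>k\<close> edges closes up from \<open>p s\<close> to
        \<open>p 0\<close>. Since \<open>d 0 s\<close> is at least 3, two closing vertices remain
        besides \<open>w'\<close>.\<close>
      have "sg p (i + (k - Suc i) + 1) (p 0) (p s) ({0..2 * i} \<union> {2 * i + 2..2 * k}) (insert w' ({} \<union> {}))"
        using e' r s s2 i False by (intro sgm_link[OF p L R]) auto
      then have "sg p k (p 0) (p s) ({0..2 * i} \<union> {2 * i + 2..2 * k}) {w'}" using len by simp
      moreover have "card (outp p (p 0) (p s) - {w'}) \<ge> 2" 
        using D(1) diff_card_le_card_Diff[of "{w'}" "outp p (p 0) (p s)"] by simp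
      ultimately show False by (rule cycle_two')
    qed
  qed
qed

text \<open>Two such vertices would close the whole path in two ways.\<close>

lemma ends:
  assumes "s \<ge> 2 * k - 1" "s \<le> 2 * k"
  shows "d 0 s \<le> 1"
proof (rule ccontr)
  assume "\<not> d 0 s \<le> 1"
  moreover have "sg p k (p 0) (p s) {0..2 * k} {}" using sgm_seg[OF p, of 0 k 0 s] assms k by auto
  ultimately show False using cycle_two'[of p "p 0" "p s" _ "{}"] by auto
qed

text \<open>Two new edges \<open>p 1\<close>, \<open>w\<close>, \<open>p 0\<close> and
  \<open>p 0\<close>, \<open>w'\<close>, \<open>p s\<close> could replace edge 0; the last
  hypothesis makes \<open>w\<close> and \<open>w'\<close> distinct.\<close>

lemma start:
  assumes "s \<in> {2, 3}" "outp p (p 0) (p 1) \<noteq> {}" "outp p (p 0) (p s) \<noteq> {}" "d 0 1 \<ge> 2 \<or> d 0 s \<ge> 2"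
  shows False
proof -
  obtain w w' where w: "w \<in> outp p (p 0) (p 1)" "w' \<in> outp p (p 0) (p s)" "w \<noteq> w'"
  proof (cases "d 0 1 \<ge> 2")
    case True
    obtain w' where "w' \<in> outp p (p 0) (p s)" using assms by auto
    moreover obtain w where "w \<in> outp p (p 0) (p 1)" "w \<notin> {w'}"
      using avoid[of "{w'}" "outp p (p 0) (p 1)"] True by auto
    ultimately show ?thesis using that by auto
  next
    case False
    then have "d 0 s \<ge> 2" using assms by auto
    obtain w where "w \<in> outp p (p 0) (p 1)" using assms by auto
    moreover obtain w' where "w' \<in> outp p (p 0) (p s)" "w' \<notin> {w}"
      using avoid[of "{w}" "outp p (p 0) (p s)"] \<open>d 0 s \<ge> 2\<close> by auto
    ultimately show ?thesis using that by auto
  qed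
  note e = outs_edge[OF w(1)] and e' = outs_edge[OF w(2)]
  have R: "sg p (k - 1) (p s) (p (2 * k)) {2..2 * k} {}" using sgm_seg[OF p, of 1 k s "2 * k"] assms(1) k by auto
  have "sg p (0 + 0 + 1) (p 1) (p 0) ({1} \<union> {0}) (insert w ({} \<union> {}))"
    using e k by (intro sgm_link[OF p sgm_point sgm_point]) auto
  note S = this
    have "0 + 0 + 1 + (k - 1) + 1 \<le> k"
      by (rule no_seg[OF sgm_link[OF p S R, of w']]) (use e' w k in auto)
  then show False using k by simp
qed

text \<open>Edge 0 is given up, and its vertices \<open>p a\<close>, \<open>p b\<close> are spliced into the rest of the path:
  both at edge \<open>i\<close>, or at two different edges.\<close>

lemma absorb_one:
  assumes ab: "{a, b} = {0, 1}" "a \<noteq> b" and i: "1 \<le> i" "i < k"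
    and y: "2 \<le> y" "y \<le> 2 * i" "2 * i \<le> y + 1"
    and x: "2 * i + 2 \<le> x" "x \<le> 2 * i + 3" "x \<le> 2 * k"
    and D: "d a y \<ge> 4" "d a (2 * i + 1) \<ge> 4" "d b (2 * i + 1) \<ge> 4" "d b x \<ge> 4"
  shows False
proof -
  have ab': "a = 0 \<and> b = 1 \<or> a = 1 \<and> b = 0" using ab by (auto simp: doubleton_eq_iff)
  \<comment> \<open>Four linking vertices are chosen one after another; this is why fat means
    codegree at least 4.\<close>
  obtain w1 where w1: "w1 \<in> outp p (p a) (p y)" using D by fastforce
  obtain w2 where w2: "w2 \<in> outp p (p a) (p (2 * i + 1))" "w2 \<notin> {w1}"
    by (rule avoid[of "{w1}" "outp p (p a) (p (2 * i + 1))"]) (use D in auto)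
  obtain w3 where w3: "w3 \<in> outp p (p b) (p (2 * i + 1))" "w3 \<notin> {w1, w2}"
    by (rule avoid[of "{w1, w2}" "outp p (p b) (p (2 * i + 1))"]) (use D w2 in auto)
  obtain w4 where w4: "w4 \<in> outp p (p b) (p x)" "w4 \<notin> {w1, w2, w3}"
    by (rule avoid[of "{w1, w2, w3}" "outp p (p b) (p x)"]) (use D w2 w3 in auto)
  have M: "sg p (i - 1) (p 2) (p y) {2..2 * i} {}"
    using sgm_seg[OF p, of 1 i 2 y] i y by auto
  have R: "sg p (k - Suc i) (p x) (p (2 * k)) {2 * i + 2..2 * k} {}"
    using right_seg i x by auto
  \<comment> \<open>The new path runs from \<open>p 2\<close> to \<open>p y\<close>, then through
    \<open>p a\<close>, \<open>p (2 * i + 1)\<close> and \<open>p b\<close> to \<open>p x\<close>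
    and on to the end. Edges 0 and \<open>i\<close> are lost and four edges are gained.\<close>
  have "sg p (i - 1 + 0 + 1) (p 2) (p a) ({2..2 * i} \<union> {a}) (insert w1 ({} \<union> {}))"
    using outs_edge[OF w1] k ab' by (intro sgm_link[OF p M sgm_point]) auto
  then have "sg p (i - 1 + 0 + 1 + 0 + 1) (p 2) (p (2 * i + 1))
      (({2..2 * i} \<union> {a}) \<union> {2 * i + 1}) (insert w2 (insert w1 ({} \<union> {}) \<union> {}))"
    using outs_edge[OF w2(1)] w2(2) i ab' by (elim sgm_link[OF p _ sgm_point]) auto
  then have "sg p (i - 1 + 0 + 1 + 0 + 1 + 0 + 1) (p 2) (p b)
      ((({2..2 * i} \<union> {a}) \<union> {2 * i + 1}) \<union> {b}) (insert w3 (insert w2 (insert w1 ({} \<union> {}) \<union> {}) \<union> {}))"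
    using outs_edge[OF w3(1)] w3(2) k ab' i by (elim sgm_link[OF p _ sgm_point]) auto
  note S = this
    have "i - 1 + 0 + 1 + 0 + 1 + 0 + 1 + (k - Suc i) + 1 \<le> k"
      by (rule no_seg[OF sgm_link[OF p S R, of w4]]) (use outs_edge[OF w4(1)] w4(2) ab' in auto)
  then show False using i by simp
qed

lemma absorb_two:
  assumes ab: "{a, b} = {0, 1}" "a \<noteq> b" and i: "1 \<le> i" "i < j" "j < k"
    and y: "2 \<le> y" "y \<le> 2 * i" "2 * i \<le> y + 1"
    and x: "2 * i + 2 \<le> x" "x \<le> 2 * i + 3" "x \<le> 2 * j"
    and y': "2 * i + 2 \<le> y'" "y' \<le> 2 * j" "2 * j \<le> y' + 1" "x = y' \<Longrightarrow> Suc i = j"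
    and x': "2 * j + 2 \<le> x'" "x' \<le> 2 * j + 3" "x' \<le> 2 * k"
    and D: "d a y \<ge> 4" "d a x \<ge> 4" "d b y' \<ge> 4" "d b x' \<ge> 4"
  shows False
proof -
  have ab': "a = 0 \<and> b = 1 \<or> a = 1 \<and> b = 0" using ab by (auto simp: doubleton_eq_iff)
  obtain w1 where w1: "w1 \<in> outp p (p a) (p y)" using D by fastforce
  obtain w2 where w2: "w2 \<in> outp p (p a) (p x)" "w2 \<notin> {w1}"
    by (rule avoid[of "{w1}" "outp p (p a) (p x)"]) (use D in auto)
  obtain w3 where w3: "w3 \<in> outp p (p b) (p y')" "w3 \<notin> {w1, w2}"
    by (rule avoid[of "{w1, w2}" "outp p (p b) (p y')"]) (use D w2 in auto)
  obtain w4 where w4: "w4 \<in> outp p (p b) (p x')" "w4 \<notin> {w1, w2, w3}"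
    by (rule avoid[of "{w1, w2, w3}" "outp p (p b) (p x')"]) (use D w2 w3 in auto)
  have M: "sg p (i - 1) (p 2) (p y) {2..2 * i} {}"
    using sgm_seg[OF p, of 1 i 2 y] i y by auto
  have N: "sg p (j - Suc i) (p x) (p y') {2 * i + 2..2 * j} {}"
    using sgm_seg[OF p, of "Suc i" j x y'] i x y' by auto
  have R: "sg p (k - Suc j) (p x') (p (2 * k)) {2 * j + 2..2 * k} {}"
    using right_seg i x' by auto
  \<comment> \<open>Here \<open>p a\<close> bridges the gap at edge \<open>i\<close> and
    \<open>p b\<close> the gap at edge \<open>j\<close>. Edges 0, \<open>i\<close> and
    \<open>j\<close> are lost and four edges are gained.\<close>
  have "sg p (i - 1 + 0 + 1) (p 2) (p a) ({2..2 * i} \<union> {a}) (insert w1 ({} \<union> {}))"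
    using outs_edge[OF w1] k ab' by (intro sgm_link[OF p M sgm_point]) auto
  then have "sg p (i - 1 + 0 + 1 + (j - Suc i) + 1) (p 2) (p y')
      (({2..2 * i} \<union> {a}) \<union> {2 * i + 2..2 * j}) (insert w2 (insert w1 ({} \<union> {}) \<union> {}))"
    using outs_edge[OF w2(1)] w2(2) i ab' by (elim sgm_link[OF p _ N]) auto
  then have "sg p (i - 1 + 0 + 1 + (j - Suc i) + 1 + 0 + 1) (p 2) (p b)
      ((({2..2 * i} \<union> {a}) \<union> {2 * i + 2..2 * j}) \<union> {b}) (insert w3 (insert w2 (insert w1 ({} \<union> {}) \<union> {}) \<union> {}))"
    using outs_edge[OF w3(1)] w3(2) k ab' i by (elim sgm_link[OF p _ sgm_point]) auto
  note S = this
    have "i - 1 + 0 + 1 + (j - Suc i) + 1 + 0 + 1 + (k - Suc j) + 1 \<le> k"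
      by (rule no_seg[OF sgm_link[OF p S R, of w4]]) (use outs_edge[OF w4(1)] w4(2) ab' i in auto)
  then show False using i by simp
qed

end
end

section \<open>Greedy matching of fat positions to marked edges\<close>

text \<open>Matching each \<open>s\<close> with \<open>f s\<close> to an index \<open>i\<close> with \<open>s \<in> {2 * i + 1..2 * i + 3}\<close> is greedy from
  the left; \<open>chain f j\<close> says that index \<open>j - 1\<close> is not available for \<open>2 * j + 1\<close>.\<close>

fun chain :: "(nat \<Rightarrow> bool) \<Rightarrow> nat \<Rightarrow> bool" where
  "chain f 0 = True"
| "chain f (Suc j) = (f (2 * j + 2) \<or> chain f j \<and> f (2 * j + 1))"

text \<open>Going left, a chain of odd positions ends either at an even position, which has only one
  index, or at the beginning of the path.\<close>

lemma chain_start: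
  "chain f j \<Longrightarrow> (\<exists>i\<ge>1. i \<le> j \<and> f (2 * i) \<and> (\<forall>l. i \<le> l \<and> l < j \<longrightarrow> f (2 * l + 1)))
    \<or> (\<forall>l<j. f (2 * l + 1))"
proof (induction j)
  case (Suc j)
  show ?case
  proof (cases "f (2 * j + 2)")
    case True
    then show ?thesis by (intro disjI1 exI[of _ "Suc j"]) auto
  next
    case False
    then have "chain f j" "f (2 * j + 1)" using Suc.prems by auto
    then show ?thesis using Suc.IH by (metis le_Suc_eq less_Suc_eq)
  qed
qed simp

lemma chain_count:
  assumes "\<And>l. l < j \<Longrightarrow> \<not> (chain f l \<and> f (2 * l + 1) \<and> f (2 * l + 2))"
  shows "(\<Sum>l<j. of_bool (f (2 * l + 1)) + of_bool (f (2 * l + 2)))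
      + (if \<not> chain f j \<and> f (2 * j + 1) then 1 else 0)
    \<le> (\<Sum>l<j. of_bool (f (2 * l + 1) \<or> f (2 * l + 2) \<or> f (2 * l + 3)) :: nat)"
  using assms
proof (induction j)
  case (Suc j)
  have viol: "\<not> (chain f j \<and> f (2 * j + 1) \<and> f (2 * j + 2))" using Suc.prems[of j] by simp
  have eq: "2 * Suc j + 1 = 2 * j + 3" by simp
  have IH: "(\<Sum>l<j. of_bool (f (2 * l + 1)) + of_bool (f (2 * l + 2)))
      + (if \<not> chain f j \<and> f (2 * j + 1) then 1 else 0)
    \<le> (\<Sum>l<j. of_bool (f (2 * l + 1) \<or> f (2 * l + 2) \<or> f (2 * l + 3)) :: nat)"
    by (rule Suc.IH, rule Suc.prems) simp
  have step: "S + (of_bool a + of_bool b) + (if \<not> (b \<or> c \<and> a) \<and> e then 1 else 0) \<le> T + of_bool (a \<or> b \<or> e)"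
    if "\<not> (c \<and> a \<and> b)" "S + (if \<not> c \<and> a then 1 else 0) \<le> T" for S T :: nat and a b c e
    using that by (cases a; cases b; cases c; cases e) simp_all
  show ?case unfolding sum.lessThan_Suc chain.simps eq by (rule step[OF viol IH])
qed simp

lemma card_pairs_sum:
  fixes k :: nat
  shows "card {s \<in> {1..2 * k}. f s} = (\<Sum>l<k. of_bool (f (2 * l + 1)) + of_bool (f (2 * l + 2)))"
proof (induction k)
  case (Suc k)
  have "{s \<in> {1..2 * Suc k}. f s} = {s \<in> {1..2 * k}. f s} \<union>
    ((if f (2 * k + 1) then {2 * k + 1} else {}) \<union> (if f (2 * k + 2) then {2 * k + 2} else {}))"
    by (auto simp: le_Suc_eq)
  moreover have "card \<dots> = card {s \<in> {1..2 * k}. f s} +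
    card ((if f (2 * k + 1) then {2 * k + 1} else {}) \<union> (if f (2 * k + 2) then {2 * k + 2} else {}))"
    by (rule card_Un_disjoint) auto
  ultimately show ?case using Suc by simp
qed simp

lemma card_less_sum:
  fixes k :: nat
  shows "card {i. i < k \<and> P i} = (\<Sum>l<k. of_bool (P l) :: nat)"
proof -
  have "{i. i < k \<and> P i} = {..<k} \<inter> {i. P i}" by auto
  then show ?thesis by simp
qed

text \<open>A block violates Hall's condition: its \<open>j - i + 2\<close> positions can only use
  the \<open>j - i + 1\<close> indices from \<open>i - 1\<close> to \<open>j - 1\<close>.\<close>

definition blk :: "nat \<Rightarrow> (nat \<Rightarrow> bool) \<Rightarrow> nat \<Rightarrow> nat \<Rightarrow> bool" where
  "blk k f i j \<longleftrightarrow> 1 \<le> i \<and> i < j \<and> j \<le> k \<and> f (2 * i) \<and> f (2 * j) \<and>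
     (\<forall>l. i \<le> l \<and> l < j \<longrightarrow> f (2 * l + 1))"

text \<open>A failure of the greedy matching at \<open>l\<close> traces back along its chain: to an
  even position, which gives a block ending at \<open>l + 1\<close>, or to position 1, where 1 and 2
  or 1 and 3 are both present.\<close>

lemma no_blk_count:
  assumes blk: "\<And>i j. \<not> blk k f i j" and "\<not> (f 1 \<and> f 2)" "\<not> (f 1 \<and> f 3)"
  shows "card {s \<in> {1..2 * k}. f s} \<le> card {i. i < k \<and> (f (2 * i + 1) \<or> f (2 * i + 2) \<or> f (2 * i + 3))}"
proof -
  have "\<not> (chain f l \<and> f (2 * l + 1) \<and> f (2 * l + 2))" if l: "l < k" for l
  proof
    assume h: "chain f l \<and> f (2 * l + 1) \<and> f (2 * l + 2)"
    from chain_start[OF conjunct1[OF h]] show False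
    proof
      assume "\<exists>i\<ge>1. i \<le> l \<and> f (2 * i) \<and> (\<forall>l'. i \<le> l' \<and> l' < l \<longrightarrow> f (2 * l' + 1))"
      then obtain i where i: "1 \<le> i" "i \<le> l" "f (2 * i)" "\<And>l'. i \<le> l' \<Longrightarrow> l' < l \<Longrightarrow> f (2 * l' + 1)"
        by blast
      have "f (2 * l' + 1)" if "i \<le> l'" "l' < Suc l" for l'
        using i(4)[of l'] that h by (cases "l' = l") auto
      then have "blk k f i (Suc l)" using i h l by (auto simp: blk_def)
      then show False using blk by simp
    next
      assume a: "\<forall>l'<l. f (2 * l' + 1)"
      show False
      proof (cases "l = 0")
        case True
        then show False using h assms(2) by (simp add: numeral_2_eq_2)
      next
        case False
        then have "f (2 * 0 + 1)" using a by blast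
        moreover have "f (2 * 1 + 1)"
        proof (cases "l = 1")
          case True
          then show ?thesis using h by metis
        next
          case l: False
          then have "1 < l" using False by simp
          then show ?thesis using a by blast
        qed
        ultimately show False using assms(3) by simp
      qed
    qed
  qed
  then show ?thesis unfolding card_pairs_sum card_less_sum
    using chain_count[of k f] by (simp del: One_nat_def)
qed


section \<open>Blocks and the choice of the ends\<close>

context no_longer_path
begin

abbreviation deg_out :: "(nat \<Rightarrow> 'a) \<Rightarrow> nat \<Rightarrow> nat \<Rightarrow> nat" where
  "deg_out p a s \<equiv> card (outp p (p a) (p s))"

abbreviation fat :: "(nat \<Rightarrow> 'a) \<Rightarrow> nat \<Rightarrow> nat \<Rightarrow> bool" where
  "fat p a s \<equiv> 4 \<le> deg_out p a s"

text \<open>In general \<open>p a\<close> is inserted at the first edge of its block and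
  \<open>p b\<close> at the last edge of the other. Where the blocks leave no room for two separate
  insertions, both vertices go into one edge, on either side of its free vertex.\<close>

lemma two_blocks_ordered:
  assumes p: "vpath E k p" and ab: "{a, b} = {0, 1}" "a \<noteq> b"
    and A: "blk k (fat p a) i j" and B: "blk k (fat p b) i' j'" and le: "i \<le> i'"
  shows False
proof -
  have a: "1 \<le> i" "i < j" "j \<le> k" "fat p a (2 * i)" "fat p a (2 * j)"
    and aa: "\<And>l s. i \<le> l \<Longrightarrow> l < j \<Longrightarrow> s = 2 * l + 1 \<Longrightarrow> fat p a s" using A by (auto simp: blk_def)
  have b: "1 \<le> i'" "i' < j'" "j' \<le> k" "fat p b (2 * i')" "fat p b (2 * j')"
    and bb: "\<And>l s. i' \<le> l \<Longrightarrow> l < j' \<Longrightarrow> s = 2 * l + 1 \<Longrightarrow> fat p b s" using B by (auto simp: blk_def)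
  note one = absorb_one[OF p ab] and two = absorb_two[OF p ab]
  \<comment> \<open>The block guarantees that \<open>2 * i + 2\<close> is fat only if it ends there;
    otherwise the free vertex of the next edge is used.\<close>
  define x where "x = (if j = i + 1 then 2 * i + 2 else 2 * i + 3)"
  have x: "fat p a x" "x = 2 * i + 2 \<or> x = 2 * i + 3 \<and> i + 1 < j"
    using a aa[of "i + 1" "2 * i + 3"] by (auto simp: x_def)
  show False
  proof (cases "i = i'")
    case True
    define z where "z = (if j' = i + 1 then 2 * i + 2 else 2 * i + 3)"
    have z: "fat p b z" "z = 2 * i + 2 \<or> z = 2 * i + 3 \<and> i + 1 < j'"
      using b bb[of "i + 1" "2 * i + 3"] True by (auto simp: z_def)
    show False using True a b aa[of i "2 * i + 1"] bb[of i "2 * i + 1"] z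
      by (intro one[of i "2 * i" z]) auto
  next
    case False
    \<comment> \<open>\<open>J\<close> is the last edge of the second block.\<close>
    define J where "J = j' - 1"
    have J: "j' = J + 1" "i < J" "i' \<le> J" "J < k" using b False le by (auto simp: J_def)
    show False
    proof (cases "J = i + 1")
      case 1: True
      then have i': "i' = J" using J le False by simp
      show False
      proof (cases "j = i + 1")
        case True
        then have "x = 2 * i + 2" by (simp add: x_def)
        then show False using a b x i' 1 J by (intro two[of i J "2 * i" x "2 * J" "2 * j'"]) auto
      next
        case False
        then have "i + 1 < j" using a by simp
        then show False using a b aa[of i "2 * i + 1"] aa[of "i + 1" "2 * J + 1"]
            bb[of "i + 1" "2 * J + 1"] i' 1 J
          by (intro one[of J "2 * i + 1" "2 * j'"]) auto
      qed
    next
      case 2: False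
      obtain c where c: "J = Suc c" using J by (cases J) auto
      define y where "y = (if i' < J then 2 * J - 1 else 2 * J)"
      have y: "fat p b y" "y = 2 * J \<or> Suc y = 2 * J \<and> i' < J"
        using b J bb[of c "2 * J - 1"] c by (auto simp: y_def)
      show False
      proof (cases "x = y")
        case False
        then show False using a b x y 2 J by (intro two[of i J "2 * i" x y "2 * j'"]) auto
      next
        case True
        \<comment> \<open>The segment between the two insertions would need the same free vertex at
          both ends, so both go into edge \<open>i + 1\<close>.\<close>
        then have "x = 2 * i + 3" "i + 1 < j" "J = i + 2" "i' < J" using x(2) y(2) 2 J by presburger+
        then show False using a b aa[of i "2 * i + 1"] aa[of "i + 1" "2 * (i + 1) + 1"]
            bb[of "i + 1" "2 * (i + 1) + 1"] bb[of "i + 2" "2 * i + 5"] J le \<open>i \<noteq> i'\<close>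
          by (intro one[of "i + 1" "2 * i + 1" "2 * i + 5"]) auto
      qed
    qed
  qed
qed

lemma two_blocks:
  assumes p: "vpath E k p" and A: "blk k (fat p 0) i j" and B: "blk k (fat p 1) i' j'"
  shows False
proof (cases "i \<le> i'")
  case True
  show False by (rule two_blocks_ordered[OF p _ _ A B True]) auto
next
  case False
  then show False by (intro two_blocks_ordered[OF p _ _ B A]) auto
qed

abbreviation swap :: "(nat \<Rightarrow> 'a) \<Rightarrow> nat \<Rightarrow> 'a" where
  "swap p \<equiv> p(0 := p 1, 1 := p 0)"

abbreviation rv :: "(nat \<Rightarrow> 'a) \<Rightarrow> nat \<Rightarrow> 'a" where
  "rv p \<equiv> (\<lambda>s. p (2 * k - s))"

definition good :: "(nat \<Rightarrow> 'a) \<Rightarrow> bool" where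
  "good p \<longleftrightarrow> (\<forall>i j. \<not> blk k (fat p 0) i j)"

lemma outs_cong: "p ` {..2 * k} = q ` {..2 * k} \<Longrightarrow> outp p = outp q"
  by (simp add: outs_def fun_eq_iff)

text \<open>Blocks use positions from 2 on, so a block of the swapped path is a block for
  \<open>p 1\<close> on the old one.\<close>

lemma good_swap:
  assumes p: "vpath E k p" shows "good p \<or> good (swap p)"
proof (rule ccontr)
  assume "\<not> ?thesis"
  then obtain i j i' j' where A: "blk k (fat p 0) i j" and B: "blk k (fat (swap p) 0) i' j'"
    by (auto simp: good_def)
  have "outp (swap p) = outp p" using swap_image[of k p] k by (intro outs_cong) simp
  then have "blk k (fat p 1) i' j'" using B unfolding blk_def by auto
  then show False using two_blocks[OF p A] by blast
qed

lemma fat_le: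
  assumes "vpath E k p" "fat p 0 s" "s \<le> 2 * k"
  shows "s \<le> 2 * k - 2"
  using ends[OF assms(1), of s] assms(2,3) by (cases "2 * k - 1 \<le> s") auto

text \<open>By \<open>fat_le\<close> no fat position is among the last two, so changing the far end
  of the path creates no block.\<close>

lemma good_cong:
  assumes p': "vpath E k p'" and g: "good p" and im: "p ` {..2 * k} = p' ` {..2 * k}"
    and eq: "\<And>s. s \<le> 2 * k - 2 \<Longrightarrow> p s = p' s"
  shows "good p'"
  unfolding good_def
proof (intro allI notI)
  fix i j assume B: "blk k (fat p' 0) i j"
  have o: "outp p = outp p'" by (rule outs_cong[OF im])
  have *: "fat p 0 s" if "fat p' 0 s" "s \<le> 2 * k" for s
    using fat_le[OF p' that] that(1) eq[of s] eq[of 0] o by simp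
  have "blk k (fat p 0) i j" using B unfolding blk_def by (auto intro!: *)
  then show False using g by (auto simp: good_def)
qed

lemma obtain_good:
  assumes p: "vpath E k p"
  obtains q where "vpath E k q" "good q" "good (rv q)"
proof -
  have k1: "1 \<le> k" using k by simp
  obtain p1 where p1: "vpath E k p1" "good p1"
    using good_swap[OF p] p vpath_swap[OF p k1] by blast
  note r = vpath_rev[OF p1(1)]
  show ?thesis
  proof (cases "good (rv p1)")
    case True
    then show ?thesis using that p1 by blast
  next
    case False
    then have g: "good (swap (rv p1))" using good_swap[OF r] by blast
    have v: "vpath E k (swap (rv p1))" using vpath_swap[OF r k1] .
    \<comment> \<open>This is \<open>p1\<close> with its last two positions exchanged, so the near
      end stays good while the far end becomes good.\<close>
    define q where "q = rv (swap (rv p1))"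
    have q: "vpath E k q" unfolding q_def by (rule vpath_rev[OF v])
    have sw: "swap (rv p1) ` {..2 * k} = rv p1 ` {..2 * k}" by (rule swap_image[OF k1])
    have qs: "q ` {..2 * k} = swap (rv p1) ` {..2 * k}" unfolding q_def by (rule rev_image)
    have rp: "rv p1 ` {..2 * k} = p1 ` {..2 * k}" by (rule rev_image)
    have im: "q ` {..2 * k} = p1 ` {..2 * k}" using sw qs rp by simp
    have "good q"
    proof (rule good_cong[OF q p1(2)])
      show "p1 s = q s" if "s \<le> 2 * k - 2" for s
        using that k by (auto simp: q_def)
    qed (simp add: im)
    moreover have "good (rv q)"
    proof (rule good_cong[OF vpath_rev[OF q] g])
      show "swap (rv p1) ` {..2 * k} = rv q ` {..2 * k}"
        using qs rev_image[of q k] by simp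
      show "swap (rv p1) s = rv q s" if "s \<le> 2 * k - 2" for s
        using that by (simp add: q_def)
    qed
    ultimately show ?thesis using that q by blast
  qed
qed

end

section \<open>Marked edges and the final count\<close>

context no_longer_path
begin

definition fats :: "(nat \<Rightarrow> 'a) \<Rightarrow> nat set" where
  "fats p = {s \<in> {1..2 * k}. fat p 0 s}"

text \<open>The edges marked by the fat neighbours of \<open>p 0\<close>, in the form required by
  \<open>conflict\<close>.\<close>

definition hits :: "(nat \<Rightarrow> 'a) \<Rightarrow> nat set" where
  "hits p = {i. i < k \<and> (\<exists>s\<in>fats p. 2 * i + 1 \<le> s \<and> s \<le> 2 * i + 3)}"

lemma hitsI:
  assumes "i < k" "2 * i + 1 \<in> fats p \<or> 2 * i + 2 \<in> fats p \<or> 2 * i + 3 \<in> fats p"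
  shows "i \<in> hits p"
proof -
  obtain s where s: "s \<in> fats p" "s = 2 * i + 1 \<or> s = 2 * i + 2 \<or> s = 2 * i + 3"
    using assms(2) by metis
  then have "2 * i + 1 \<le> s \<and> s \<le> 2 * i + 3" by auto
  then show ?thesis using assms(1) s(1) unfolding hits_def by blast
qed

lemma finite_fats: "finite (fats p)" and finite_hits: "finite (hits p)"
  by (auto simp: fats_def hits_def)

text \<open>Goodness excludes blocks and \<open>start\<close> excludes position 1 together with 2 or
  3, so the greedy matching succeeds.\<close>

lemma card_fats_le:
  assumes p: "vpath E k p" and g: "good p"
  shows "card (fats p) \<le> card (hits p)"
proof -
  let ?f = "\<lambda>s. s \<in> fats p"
  have nb: "\<not> blk k ?f i j" for i j
  proof
    assume "blk k ?f i j"
    then have "blk k (fat p 0) i j" unfolding blk_def fats_def by auto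
    then show False using g by (auto simp: good_def)
  qed
  have st: "\<not> (?f 1 \<and> ?f s)" if "s \<in> {2, 3}" for s
  proof
    assume "?f 1 \<and> ?f s"
    then have h: "4 \<le> deg_out p 0 1" "4 \<le> deg_out p 0 s" by (auto simp: fats_def)
    have "outp p (p 0) (p 1) \<noteq> {}" "outp p (p 0) (p s) \<noteq> {}" using h by fastforce+
    then show False using start[OF p that] h by linarith
  qed
  have c1: "card {s \<in> {1..2 * k}. ?f s}
      \<le> card {i. i < k \<and> (?f (2 * i + 1) \<or> ?f (2 * i + 2) \<or> ?f (2 * i + 3))}"
    using st[of 2] st[of 3] nb by (intro no_blk_count) auto
  have c2: "{s \<in> {1..2 * k}. ?f s} = fats p" by (auto simp: fats_def)
  have c3: "{i. i < k \<and> (?f (2 * i + 1) \<or> ?f (2 * i + 2) \<or> ?f (2 * i + 3))} \<subseteq> hits p"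
    using hitsI by auto
  show ?thesis using order_trans[OF c1 card_mono[OF finite_hits c3]] unfolding c2 .
qed

lemma hits_empty:
  assumes p: "vpath E k p" and i: "i \<in> hits p" and r: "2 * i \<le> r + 1" "r \<le> 2 * i + 1"
  shows "outp p (p (2 * k)) (p r) = {}"
proof (rule ccontr)
  assume ne: "outp p (p (2 * k)) (p r) \<noteq> {}"
  obtain s where s: "i < k" "s \<in> fats p" "2 * i + 1 \<le> s" "s \<le> 2 * i + 3"
    using i by (auto simp: hits_def)
  then have "s \<le> 2 * k" "3 \<le> deg_out p 0 s" by (auto simp: fats_def)
  then show False using conflict[OF p s(1,3,4) _ r _ ne] by blast
qed

lemma outp_rv: "outp (rv p) = outp p"
  by (rule outs_cong) (rule rev_image)

text \<open>Edge \<open>j\<close> of the reversed path is edge \<open>k - 1 - j\<close> of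
  \<open>p\<close>. If both ends marked it, a fat neighbour of \<open>p (2 * k)\<close> would lie
  where \<open>hits_empty\<close> allows no neighbour.\<close>

lemma hits_disjoint:
  assumes p: "vpath E k p"
  shows "card (hits p) + card (hits (rv p)) \<le> k"
proof -
  let ?g = "\<lambda>j. k - 1 - j"
  have "hits p \<inter> ?g ` hits (rv p) = {}"
  proof (rule ccontr)
    assume "\<not> ?thesis"
    then obtain j where j: "j \<in> hits (rv p)" "k - 1 - j \<in> hits p" by auto
    obtain s where s: "j < k" "s \<in> fats (rv p)" "2 * j + 1 \<le> s" "s \<le> 2 * j + 3"
      using j(1) by (auto simp: hits_def)
    have s2: "s \<le> 2 * k" "4 \<le> deg_out (rv p) 0 s" using s(2) by (auto simp: fats_def)
    then have "outp p (p (2 * k)) (p (2 * k - s)) \<noteq> {}" unfolding outp_rv by auto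
    moreover have "outp p (p (2 * k)) (p (2 * k - s)) = {}"
      using s s2(1) by (intro hits_empty[OF p j(2)]) auto
    ultimately show False by simp
  qed
  moreover have "hits p \<subseteq> {..<k}" by (auto simp: hits_def)
  moreover have "?g ` hits (rv p) \<subseteq> {..<k}" using k by auto
  moreover have "card (?g ` hits (rv p)) = card (hits (rv p))"
    by (rule card_image) (auto simp: inj_on_def hits_def)
  ultimately show ?thesis
    using card_Un_disjoint[of "hits p" "?g ` hits (rv p)"] finite_hits
      card_mono[of "{..<k}" "hits p \<union> ?g ` hits (rv p)"] by auto
qed

lemma card_outp_le:
  assumes p: "vpath E k p"
  shows "card (outp p x y) \<le> m"
proof -
  have "p s \<in> V" if s: "s \<le> 2 * k" for s
  proof -
    have e: "{p (2 * i), p (2 * i + 1), p (2 * i + 2)} \<subseteq> V" if "i < k" for i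
      using p that edgeD(1) by (auto simp: vpath_def)
    show ?thesis
    proof (cases "s = 2 * k")
      case True
      then have "s = 2 * (k - 1) + 2" using k by simp
      then show ?thesis using e[of "k - 1"] k by simp
    next
      case False
      then have "s div 2 < k" using s by auto
      moreover have "s = 2 * (s div 2) \<or> s = 2 * (s div 2) + 1" by presburger
      ultimately show ?thesis using e[of "s div 2"] by (metis insert_subset)
    qed
  qed
  then have "p ` {..2 * k} \<subseteq> V" by auto
  moreover have "card (p ` {..2 * k}) = 2 * k + 1" using p by (simp add: vpath_def card_image)
  ultimately have "card (V - p ` {..2 * k}) = m" using card_V finite_V by (simp add: card_Diff_subset)
  moreover have "outp p x y \<subseteq> V - p ` {..2 * k}" using edgeD(1) by (auto simp: outs_def)
  ultimately show ?thesis using card_mono[of "V - p ` {..2 * k}"] finite_V by auto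
qed

text \<open>A fat position contributes at most \<open>m\<close>, a position ruled out by a mark of
  the other end nothing, any other at most 3.\<close>

lemma sum_upper:
  assumes p: "vpath E k p"
  shows "(\<Sum>s=1..2 * k. deg_out p 0 s) + 3 * card (fats p) + 6 * card (hits (rv p))
    \<le> card (fats p) * m + 6 * k + 3"
proof -
  let ?H = "hits (rv p)"
  \<comment> \<open>Each mark of the other end rules out two positions, one even and one odd, so
    different marks do not overlap. For \<open>j = 0\<close> the odd one would be
    \<open>2 * k + 1\<close>, beyond the path; this costs the summand 3.\<close>
  define Z where "Z = (\<lambda>j. 2 * k - 2 * j) ` ?H \<union> (\<lambda>j. 2 * k - 2 * j + 1) ` (?H - {0})"
  have lt: "j < k" if "j \<in> ?H" for j using that by (simp add: hits_def)
  have emp: "outp p (p 0) (p (2 * k - r)) = {}" if "j \<in> ?H" "2 * j \<le> r + 1" "r \<le> 2 * j + 1" for j r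
    using hits_empty[OF vpath_rev[OF p] that] unfolding outp_rv by simp
  have Z0: "deg_out p 0 s = 0" if s: "s \<in> Z" for s
  proof -
    have "outp p (p 0) (p s) = {}"
      using s unfolding Z_def
    proof (elim UnE imageE)
      fix j assume "s = 2 * k - 2 * j" "j \<in> ?H"
      then show ?thesis using emp[of j "2 * j"] by simp
    next
      fix j assume j: "s = 2 * k - 2 * j + 1" "j \<in> ?H - {0}"
      then have "s = 2 * k - (2 * j - 1)" using lt[of j] by auto
      then show ?thesis using emp[of j "2 * j - 1"] j by simp
    qed
    then show ?thesis by simp
  qed
  have "2 * k - 2 * j \<in> {1..2 * k}" if "j \<in> ?H" for j using lt[OF that] by auto
  moreover have "2 * k - 2 * j + 1 \<in> {1..2 * k}" if "j \<in> ?H - {0}" for j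
    using lt[of j] that by auto
  ultimately have Zs: "Z \<subseteq> {1..2 * k}" unfolding Z_def by blast
  have finZ: "finite Z" using Zs finite_subset by blast
  have c1: "card ((\<lambda>j. 2 * k - 2 * j) ` ?H) = card ?H"
    using lt by (intro card_image inj_onI) fastforce
  have c2: "card ((\<lambda>j. 2 * k - 2 * j + 1) ` (?H - {0})) = card (?H - {0})"
    using lt by (intro card_image inj_onI) fastforce
  have "(\<lambda>j. 2 * k - 2 * j) ` ?H \<inter> (\<lambda>j. 2 * k - 2 * j + 1) ` (?H - {0}) = {}"
  proof -
    have "2 * k - 2 * j \<noteq> 2 * k - 2 * j' + 1" for j j' :: nat by presburger
    then show ?thesis by blast
  qed
  then have "card Z = card ?H + card (?H - {0})"
    unfolding Z_def using finite_hits c1 c2 by (subst card_Un_disjoint) auto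
  then have cZ: "2 * card ?H \<le> card Z + 1" using card_Diff1_le[of ?H 0]
    using card_Suc_Diff1[OF finite_hits[of "rv p"], of 0] by (cases "0 \<in> ?H") auto
  have FZ: "fats p \<inter> Z = {}" using Z0 by (fastforce simp: fats_def)
  let ?R = "{1..2 * k} - fats p - Z"
  have split: "{1..2 * k} = fats p \<union> Z \<union> ?R" using Zs by (auto simp: fats_def)
  have "(\<Sum>s=1..2 * k. deg_out p 0 s) = (\<Sum>s\<in>fats p. deg_out p 0 s) + (\<Sum>s\<in>Z. deg_out p 0 s)
      + (\<Sum>s\<in>?R. deg_out p 0 s)"
  proof -
    have "sum (deg_out p 0) (fats p \<union> Z \<union> ?R) = sum (deg_out p 0) (fats p \<union> Z) + sum (deg_out p 0) ?R"
      using finZ finite_fats by (intro sum.union_disjoint) auto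
    also have "sum (deg_out p 0) (fats p \<union> Z) = sum (deg_out p 0) (fats p) + sum (deg_out p 0) Z"
      using finZ finite_fats FZ by (intro sum.union_disjoint) auto
    finally show ?thesis using split by metis
  qed
  also have "(\<Sum>s\<in>fats p. deg_out p 0 s) \<le> card (fats p) * m"
    using sum_bounded_above[of "fats p" "deg_out p 0" m] card_outp_le[OF p] by simp
  also have "(\<Sum>s\<in>Z. deg_out p 0 s) = 0" using Z0 by simp
  also have "(\<Sum>s\<in>?R. deg_out p 0 s) \<le> card ?R * 3"
    using sum_bounded_above[of ?R "deg_out p 0" 3] by (force simp: fats_def)
  finally have S: "(\<Sum>s=1..2 * k. deg_out p 0 s) \<le> card (fats p) * m + card ?R * 3" by simp
  have "card {1..2 * k} = card (fats p \<union> Z \<union> ?R)" using split by simp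
  also have "\<dots> = card (fats p \<union> Z) + card ?R"
    using finZ finite_fats by (intro card_Un_disjoint) auto
  also have "card (fats p \<union> Z) = card (fats p) + card Z"
    using finZ finite_fats FZ by (intro card_Un_disjoint)
  finally have "2 * k = card (fats p) + card Z + card ?R" by simp
  then show ?thesis using S cZ by linarith
qed

text \<open>An edge at \<open>p 0\<close> lies inside the path or has exactly one outside vertex.
  The former number at most \<open>(2 * k) choose 2\<close>; the rest of the degree is the codegree
  sum.\<close>

lemma sum_lower:
  assumes p: "vpath E k p"
  shows "k * m + k\<^sup>2 + 6 \<le> 2 * (\<Sum>s=1..2 * k. deg_out p 0 s)"
proof -
  let ?P = "p ` {1..2 * k}"
  let ?A = "insert (p 0) ` {B. B \<subseteq> ?P \<and> card B = 2}"
  let ?B = "\<lambda>s. (\<lambda>w. {p 0, p s, w}) ` outp p (p 0) (p s)"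
  have full: "p ` {..2 * k} = insert (p 0) ?P"
  proof -
    have "{..2 * k} = insert 0 {1..2 * k}" by auto
    then show ?thesis by simp
  qed
  have cover: "{e \<in> E. p 0 \<in> e} \<subseteq> ?A \<union> (\<Union>s\<in>{1..2 * k}. ?B s)"
  proof
    fix e assume "e \<in> {e \<in> E. p 0 \<in> e}"
    then have e: "e \<in> E" "p 0 \<in> e" by auto
    obtain x y where xy: "e = {p 0, x, y}" "p 0 \<noteq> x" "p 0 \<noteq> y" "x \<noteq> y"
      by (rule card_3_with[OF edgeD(2)[OF e(1)] e(2)])
    have one: "e \<in> (\<Union>s\<in>{1..2 * k}. ?B s)" if h: "e = {p 0, x, y}" "x \<in> ?P" "y \<notin> ?P" "p 0 \<noteq> y" for x y
    proof -
      obtain s where s: "s \<in> {1..2 * k}" "x = p s" using h by auto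
      have "y \<in> outp p (p 0) (p s)" using h s e(1) full by (auto simp: outs_def)
      then show ?thesis using s h(1) by blast
    qed
    consider "x \<in> ?P" "y \<in> ?P" | "x \<in> ?P" "y \<notin> ?P" | "x \<notin> ?P" "y \<in> ?P" | "x \<notin> ?P" "y \<notin> ?P"
      by argo
    then show "e \<in> ?A \<union> (\<Union>s\<in>{1..2 * k}. ?B s)"
    proof cases
      case 1
      then have "{x, y} \<in> {B. B \<subseteq> ?P \<and> card B = 2}" using xy(4) by simp
      then have "e \<in> ?A" unfolding xy(1) by (rule imageI)
      then show ?thesis by (rule UnI1)
    next
      case 2
      from one[OF xy(1) 2 xy(3)] show ?thesis by (rule UnI2)
    next
      case 3
      have "e = {p 0, y, x}" using xy(1) by (simp add: insert_commute)
      from one[OF this 3(2,1) xy(2)] show ?thesis by (rule UnI2)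
    next
      case 4
      \<comment> \<open>With both other vertices outside, the edge would extend the path.\<close>
      have L: "lseg E k (p 0) (p (2 * k)) (p ` {..2 * k})"
        using vpath_lseg_from[OF p, of 0 k 0] by (simp add: atLeast0AtMost)
      have xy': "x \<notin> p ` {..2 * k}" "y \<notin> p ` {..2 * k}" using 4 xy(2,3) unfolding full by simp_all
      have e': "{x, y, p 0} \<in> E" using e(1) xy(1) by (simp add: insert_commute)
      from lseg_contains[OF lseg.cons[OF e' xy(4) L xy']] show ?thesis using no_path by simp
    qed
  qed
  have cP: "finite ?P" "card ?P = 2 * k"
    using p card_image[of p "{1..2 * k}"] inj_on_subset[of p "{..2 * k}" "{1..2 * k}"]
    by (auto simp: vpath_def)
  have cA: "card ?A \<le> (2 * k) choose 2"
  proof -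
    have "card ?A \<le> card {B. B \<subseteq> ?P \<and> card B = 2}" using cP by (intro card_image_le) auto
    then show ?thesis using n_subsets[OF cP(1)] cP(2) by simp
  qed
  have "card (\<Union>s\<in>{1..2 * k}. ?B s) \<le> (\<Sum>s\<in>{1..2 * k}. card (?B s))"
    by (rule card_UN_le) simp
  also have "\<dots> \<le> (\<Sum>s=1..2 * k. deg_out p 0 s)"
    by (intro sum_mono card_image_le finite_outs)
  finally have cB: "card (\<Union>s\<in>{1..2 * k}. ?B s) \<le> (\<Sum>s=1..2 * k. deg_out p 0 s)" .
  have "vertex_degree E (p 0) \<le> card (?A \<union> (\<Union>s\<in>{1..2 * k}. ?B s))"
    unfolding vertex_degree_def using cP finite_outs by (intro card_mono[OF _ cover]) auto
  also have "\<dots> \<le> ((2 * k) choose 2) + (\<Sum>s=1..2 * k. deg_out p 0 s)"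
    using card_Un_le[of ?A "\<Union>s\<in>{1..2 * k}. ?B s"] cA cB by linarith
  finally have D: "vertex_degree E (p 0) \<le> ((2 * k) choose 2) + (\<Sum>s=1..2 * k. deg_out p 0 s)" .
  have "2 * ((2 * k) choose 2) + 2 * k = 4 * k\<^sup>2"
  proof -
    have "(2 * k) choose 2 = k * (2 * k - 1)" by (simp add: choose_two)
    then show ?thesis using k by (simp add: power2_eq_square algebra_simps diff_mult_distrib2)
  qed
  moreover have "p 0 \<in> V"
  proof -
    have "{p (2 * 0), p (2 * 0 + 1), p (2 * 0 + 2)} \<in> E" using p k unfolding vpath_def by (meson less_le_trans pos2)
    then show ?thesis using edgeD(1) by fastforce
  qed
  ultimately show ?thesis using D degree[of "p 0"] by linarith
qed


lemma hits_rv_rv: "hits (rv (rv p)) = hits p"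
proof -
  have "outp (rv (rv p)) = outp p" by (rule trans[OF outp_rv[of "rv p"] outp_rv[of p]])
  then have "fats (rv (rv p)) = fats p" unfolding fats_def by auto
  then show ?thesis by (simp add: hits_def)
qed

text \<open>Positions 3 and 4 contribute at most 1 each by \<open>ends\<close>, and by
  \<open>start\<close> positions 1 and 2 cannot both be large.\<close>

lemma length_two_sum:
  assumes p: "vpath E k p" and k2: "k = 2"
  shows "(\<Sum>s=1..2 * k. deg_out p 0 s) \<le> m + 2"
proof -
  have S: "(\<Sum>s=1..2 * k. deg_out p 0 s) = deg_out p 0 1 + deg_out p 0 2 + deg_out p 0 3 + deg_out p 0 4"
  proof -
    have "{1..2 * k} = {1, 2, 3, 4}" using k2 by auto
    then show ?thesis by simp
  qed
  have "deg_out p 0 3 \<le> 1" "deg_out p 0 4 \<le> 1" using ends[OF p] k2 by auto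
  moreover have "deg_out p 0 1 \<le> m" "deg_out p 0 2 \<le> m" using card_outp_le[OF p] by auto
  moreover have "deg_out p 0 1 = 0 \<or> deg_out p 0 2 = 0 \<or> deg_out p 0 1 \<le> 1 \<and> deg_out p 0 2 \<le> 1"
  proof (rule ccontr)
    assume h: "\<not> ?thesis"
    then have "outp p (p 0) (p 1) \<noteq> {}" "outp p (p 0) (p 2) \<noteq> {}" by fastforce+
    moreover have "2 \<le> deg_out p 0 1 \<or> 2 \<le> deg_out p 0 2" using h by linarith
    ultimately show False using start[OF p, of 2] by blast
  qed
  ultimately show ?thesis unfolding S using m by linarith
qed

lemma no_vpath: "\<not> vpath E k p"
proof
  assume "vpath E k p"
  then obtain q where q: "vpath E k q" and g: "good q" "good (rv q)" by (rule obtain_good)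
  note q' = vpath_rev[OF q]
  define S where "S p = (\<Sum>s=1..2 * k. deg_out p 0 s)" for p
  have low: "k * m + k\<^sup>2 + 6 \<le> 2 * S q" "k * m + k\<^sup>2 + 6 \<le> 2 * S (rv q)"
    using sum_lower[OF q] sum_lower[OF q'] unfolding S_def .
  define \<alpha> \<beta> where "\<alpha> = card (fats q)" and "\<beta> = card (fats (rv q))"
  have ab: "\<alpha> \<le> card (hits q)" "\<beta> \<le> card (hits (rv q))" "\<alpha> + \<beta> \<le> k"
    using card_fats_le[OF q g(1)] card_fats_le[OF q' g(2)] hits_disjoint[OF q]
    by (simp_all add: \<alpha>_def \<beta>_def)
  have up: "S q + 3 * \<alpha> + 6 * \<beta> \<le> \<alpha> * m + 6 * k + 3"
    "S (rv q) + 3 * \<beta> + 6 * \<alpha> \<le> \<beta> * m + 6 * k + 3"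
    using sum_upper[OF q] sum_upper[OF q'] ab(1,2) unfolding hits_rv_rv \<alpha>_def \<beta>_def S_def by linarith+
  \<comment> \<open>Splitting 9 off \<open>m\<close> cancels the term \<open>9 * \<sigma>\<close> in
    \<open>tot\<close>; since \<open>\<sigma>\<close> is at most \<open>k\<close>, what remains is
    \<open>k\<^sup>2 \<le> 3 * k\<close>.\<close>
  obtain m' where m': "m = 9 + m'" "9 \<le> m'" using m le_Suc_ex[of 9 m] by auto
  define \<sigma> where "\<sigma> = \<alpha> + \<beta>"
  have sm: "\<sigma> * m = 9 * \<sigma> + \<sigma> * m'" "k * m = 9 * k + k * m'" by (simp_all add: m' algebra_simps)
  have "\<sigma> * m = \<alpha> * m + \<beta> * m" by (simp add: \<sigma>_def algebra_simps)
  then have tot: "k * m + k\<^sup>2 + 9 * \<sigma> \<le> \<sigma> * m + 12 * k"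
    using low up \<sigma>_def by linarith
  have "\<sigma> * m' \<le> k * m'" using ab(3) by (simp add: \<sigma>_def)
  then have "k\<^sup>2 \<le> 3 * k" using tot sm by linarith
  then have "k \<le> 3" using k by (simp add: power2_eq_square)
  then consider "k = 2" | "k = 3" using k by linarith
  then show False
  proof cases
    case 1
    have "S q \<le> m + 2" unfolding S_def by (rule length_two_sum[OF q 1])
    then show False using low(1) 1 by simp
  next
    case 2
    have "\<sigma> = 3"
    proof (rule ccontr)
      assume "\<sigma> \<noteq> 3"
      then have "\<sigma> \<le> 2" using ab(3) 2 by (simp add: \<sigma>_def)
      then have "\<sigma> * m' \<le> 2 * m'" by (rule mult_right_mono) simp
      then show False using tot sm 2 m' by simp
    qed
    \<comment> \<open>Some end has at most one fat neighbour, and its codegree sum is too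
      small.\<close>
    then consider "\<alpha> = 0" "\<beta> = 3" | "\<alpha> = 1" "\<beta> = 2" | "\<beta> = 0" "\<alpha> = 3" | "\<beta> = 1" "\<alpha> = 2"
      unfolding \<sigma>_def by fastforce
    then show False using low up 2 m by cases simp_all
  qed
qed

end

section \<open>A path of length two and the conclusion\<close>

text \<open>Fix an edge \<open>{v, a, b}\<close>. Either another edge at \<open>v\<close> avoids
  \<open>a\<close> and \<open>b\<close>, or all edges at \<open>v\<close> contain one of them, and
  then both codegrees are large.\<close>

lemma contains_two:
  assumes tg: "three_graph V E" and v: "v \<in> V" and deg: "card V + 6 \<le> vertex_degree E v"
  shows "contains_linear_path E 2"
proof -
  have ed: "e \<subseteq> V" "card e = 3" if "e \<in> E" for e
    using tg that by (auto simp: three_graph_def)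
  have finV: "finite V" using tg by (simp add: three_graph_def)
  let ?N = "\<lambda>a. {w. w \<noteq> v \<and> w \<noteq> a \<and> {v, a, w} \<in> E}"
  have N: "finite (?N a)" "card (?N a) + 1 \<le> card V" for a
  proof -
    have sub: "?N a \<subseteq> V - {v}" using ed(1) by blast
    then show "finite (?N a)" using finV finite_subset by blast
    have "card (?N a) \<le> card (V - {v})" using sub finV by (intro card_mono) auto
    then show "card (?N a) + 1 \<le> card V" using card_Suc_Diff1[OF finV v] by simp
  qed
  have "card {e \<in> E. v \<in> e} \<noteq> 0" using deg by (simp add: vertex_degree_def)
  then have "{e \<in> E. v \<in> e} \<noteq> {}" by (metis card.empty)
  then obtain e where e: "e \<in> E" "v \<in> e" by blast
  obtain a b where eab: "e = {v, a, b}" "v \<noteq> a" "v \<noteq> b" "a \<noteq> b"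
    by (rule card_3_with[OF ed(2)[OF e(1)] e(2)])
  show ?thesis
  proof (cases "\<exists>f\<in>E. v \<in> f \<and> a \<notin> f \<and> b \<notin> f")
    case True
    then obtain f where f: "f \<in> E" "v \<in> f" "a \<notin> f" "b \<notin> f" by blast
    obtain x y where fxy: "f = {v, x, y}" "v \<noteq> x" "v \<noteq> y" "x \<noteq> y"
      by (rule card_3_with[OF ed(2)[OF f(1)] f(2)])
    have "lseg E 1 v y {v, x, y}" using f fxy by (intro lseg_edge) auto
    moreover have "a \<notin> {v, x, y}" "b \<notin> {v, x, y}" using f(3,4) fxy(1) by auto
    moreover have "{a, b, v} \<in> E" using e(1) eab(1) by (simp add: insert_commute)
    ultimately have "lseg E (Suc 1) a y (insert a (insert b {v, x, y}))"
      using lseg.cons[OF _ eab(4)] by blast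
    then show ?thesis using lseg_contains by (metis Suc_1)
  next
    case False
    have sub: "{e \<in> E. v \<in> e} \<subseteq> (\<lambda>w. {v, a, w}) ` ?N a \<union> (\<lambda>w. {v, b, w}) ` ?N b"
    proof
      fix f assume "f \<in> {e \<in> E. v \<in> e}"
      then have f: "f \<in> E" "v \<in> f" by auto
      obtain x y where fxy: "f = {v, x, y}" "v \<noteq> x" "v \<noteq> y" "x \<noteq> y"
        by (rule card_3_with[OF ed(2)[OF f(1)] f(2)])
      have fyx: "f = {v, y, x}" using fxy(1) by (simp add: insert_commute)
      have "a \<in> f \<or> b \<in> f" using False f by blast
      then have "x = a \<or> y = a \<or> x = b \<or> y = b" using fxy(1) eab(2,3) by auto
      then show "f \<in> (\<lambda>w. {v, a, w}) ` ?N a \<union> (\<lambda>w. {v, b, w}) ` ?N b"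
      proof (elim disjE)
        assume "x = a"
        then show ?thesis using fxy f(1) by (intro UnI1 image_eqI[of _ _ y]) auto
      next
        assume "y = a"
        then show ?thesis using fxy fyx f(1) by (intro UnI1 image_eqI[of _ _ x]) auto
      next
        assume "x = b"
        then show ?thesis using fxy f(1) by (intro UnI2 image_eqI[of _ _ y]) auto
      next
        assume "y = b"
        then show ?thesis using fxy fyx f(1) by (intro UnI2 image_eqI[of _ _ x]) auto
      qed
    qed
    have "vertex_degree E v \<le> card ((\<lambda>w. {v, a, w}) ` ?N a \<union> (\<lambda>w. {v, b, w}) ` ?N b)"
      unfolding vertex_degree_def using N(1) by (intro card_mono[OF _ sub]) auto
    also have "\<dots> \<le> card (?N a) + card (?N b)"
      using card_Un_le[of "(\<lambda>w. {v, a, w}) ` ?N a" "(\<lambda>w. {v, b, w}) ` ?N b"]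
        card_image_le[OF N(1)[of a], of "\<lambda>w. {v, a, w}"] card_image_le[OF N(1)[of b], of "\<lambda>w. {v, b, w}"]
      by linarith
    \<comment> \<open>The two codegrees sum to at least \<open>card V + 6\<close>, while each is
      below \<open>card V\<close>.\<close>
    finally have big: "7 \<le> card (?N a)" "7 \<le> card (?N b)" using deg N(2)[of a] N(2)[of b] by linarith+
    obtain w where w: "w \<in> ?N a" "w \<notin> {b}" by (rule avoid[of "{b}" "?N a"]) (use big in auto)
    have "card {a, w} < card (?N b)" using big card_insert_le_m1[of 2 "{w}" a] by simp
    then obtain w' where w': "w' \<in> ?N b" "w' \<notin> {a, w}" using avoid[of "{a, w}" "?N b"] by blast
    have "lseg E 1 v w' {v, b, w'}" using w' eab by (intro lseg_edge) auto
    moreover have "a \<notin> {v, b, w'}" "w \<notin> {v, b, w'}" "a \<noteq> w" using w w' eab by auto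
    moreover have "{a, w, v} \<in> E" using w by (simp add: insert_commute)
    ultimately have "lseg E (Suc 1) a w' (insert a (insert w {v, b, w'}))"
      by (intro lseg.cons)
    then show ?thesis using lseg_contains by (metis Suc_1)
  qed
qed

theorem theorem2p5:
  fixes V :: "'a set" and E :: "'a set set" and t n :: nat
  assumes "t \<ge> 3" and "n \<ge> 2 * t + 17"
    and "three_graph V E" and "card V = n"
    and "real (min_vertex_degree V E)
           \<ge> (real t - 1) / 2 * real n + 3 / 2 * (real t)\<^sup>2 - 9 / 2 * real t + 6"
  shows "contains_linear_path E t"
proof (rule ccontr)
  assume no: "\<not> contains_linear_path E t"
  obtain T where T: "t = Suc T" "2 \<le> T" using assms(1) by (cases t) auto
  have fin: "finite V" using assms(3) by (simp add: three_graph_def)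
  have deg: "T * n + 3 * T\<^sup>2 + 6 \<le> 2 * vertex_degree E v + 3 * T" if "v \<in> V" for v
  proof -
    have "min_vertex_degree V E \<le> vertex_degree E v"
      unfolding min_vertex_degree_def using fin that by (intro Min_le) auto
    then have "real T / 2 * real n + 3 / 2 * (real T + 1)\<^sup>2 - 9 / 2 * (real T + 1) + 6 \<le> real (vertex_degree E v)"
      using assms(5) T(1) by (simp add: add.commute)
    then have "real T * real n + 3 * (real T)\<^sup>2 + 6 \<le> 2 * real (vertex_degree E v) + 3 * real T"
      by (simp add: power2_eq_square field_simps)
    then have "real (T * n + 3 * T\<^sup>2 + 6) \<le> real (2 * vertex_degree E v + 3 * T)" by simp
    then show ?thesis by (simp only: of_nat_le_iff)
  qed
  \<comment> \<open>The bound for \<open>t\<close> implies the corresponding bound for every shorter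
    length, so it can be used at the length \<open>k\<close> of a longest path.\<close>
  have mono: "j * n + 3 * j\<^sup>2 + 6 \<le> 2 * vertex_degree E v + 3 * j" if v: "v \<in> V" and j: "1 \<le> j" "j \<le> T" for v j
  proof -
    obtain d where d: "T = j + d" using j le_Suc_ex by blast
    have "T * n + 3 * T\<^sup>2 = j * n + 3 * j\<^sup>2 + d * n + 3 * d\<^sup>2 + 6 * (d * j)"
      by (simp add: d power2_eq_square algebra_simps)
    moreover have "d * 1 \<le> d * j" using j by (intro mult_le_mono2)
    ultimately show ?thesis using deg[OF v] d by linarith
  qed
  have "card V \<noteq> 0" using assms by simp
  then obtain v where v: "v \<in> V" by fastforce
  have "card V + 6 \<le> vertex_degree E v" using mono[OF v, of 2] T(2) assms(4) by simp
  then have two: "contains_linear_path E 2" by (rule contains_two[OF assms(3) v])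
  have "\<exists>k\<ge>2. k < t \<and> contains_linear_path E k \<and> \<not> contains_linear_path E (Suc k)"
  proof (rule ccontr)
    assume h: "\<not> ?thesis"
    have "j \<le> t \<longrightarrow> contains_linear_path E j" if "2 \<le> j" for j
      using that
    proof (induction j rule: dec_induct)
      case base
      then show ?case using two by simp
    next
      case (step j)
      then show ?case using h by auto
    qed
    then show False using no assms(1) by simp
  qed
  then obtain k where kt: "2 \<le> k" "k < t" "contains_linear_path E k" "\<not> contains_linear_path E (Suc k)"
    by blast
  \<comment> \<open>From \<open>n \<ge> 2 * t + 17\<close> and \<open>k \<le> t - 1\<close>, at
    least 18 vertices lie off a path with \<open>2 * k + 1\<close> vertices.\<close>
  obtain m where mn: "n = m + 2 * k + 1" "18 \<le> m"
  proof
    show "n = (n - 2 * k - 1) + 2 * k + 1" "18 \<le> n - 2 * k - 1" using kt(2) assms(2) by simp_all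
  qed
  interpret no_longer_path V E k m
  proof
    fix v assume "v \<in> V"
    from mono[OF this, of k] show "k * m + 5 * k\<^sup>2 + 6 \<le> 2 * vertex_degree E v + 2 * k"
      using kt T(1) unfolding mn(1) by (simp add: power2_eq_square algebra_simps)
  qed (use assms kt mn in auto)
  obtain p where "vpath E k p"
    by (rule contains_imp_vpath[OF kt(3)]) (use kt(1) edgeD(2) in auto)
  then show False using no_vpath by blast
qed

end
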